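(* Let $K$ be a field and let $A=\sigma(K)\langle x_1,\dots,x_n\rangle$ be a bijective skew $PBW$ extension of $K$ such that $A$ is a $K$-algebra. Let $P(A)$ be the collection of isomorphism classes $[M]$ of point modules for $A$, let $\sim$ be the relation on $P(A)$ given by $[M]\sim[M']\iff Gr(M)\cong Gr(M')$, and for $m\ge 1$ let $X_m\subseteq \prod_{i=0}^{m-1}\mathbb{P}^{n-1}$ be the closed subset associated with the finite presentation of $Gr(A)$. Then there exists $m_0\geq 1$ such that there is an injective function from $P(A)/\sim$ to the closed points of $X_{m_0}$: $$(P(A)/\sim)\longrightarrow X_{m_0}.$$
   Context: All modules are left modules and $\mathbb{N}=\{0,1,2,\dots\}$. **Skew PBW extensions.** Let $R\subseteq A$ be rings. $A$ is a skew $PBW$ extension of $R$, written $A=\sigma(R)\langle x_1,\dots,x_n\rangle$, if there are $x_1,\dots,x_n\in A$ such that: $A$ is a free left $R$-module with basis $\mathrm{Mon}(A)=\{x^\alpha=x_1^{\alpha_1}\cdots x_n^{\alpha_n}\mid\alpha\in\mathbb{N}^n\}$; for every $1\le i\le n$ and $r\in R\setminus\{0\}$ there is $c_{i,r}\in R\setminus\{0\}$ with $x_ir-c_{i,r}x_i\in R$; and for all $1\le i,j\le n$ there is $c_{i,j}\in R\setminus\{0\}$ with $x_jx_i-c_{i,j}x_ix_j\in R+Rx_1+\cdots+Rx_n$. Then for each $i$ there are an injective ring endomorphism $\sigma_i$ of $R$ and a $\sigma_i$-derivation $\delta_i$ of $R$ with $x_ir=\sigma_i(r)x_i+\delta_i(r)$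 for all $r\in R$. $A$ is bijective if every $\sigma_i$ is bijective and $c_{i,j}$ is invertible for all $1\le i<j\le n$. Here $R=K$, and "$A$ is a $K$-algebra" means that $K$ is central in $A$ (so $x_ir=rx_i$ for $r\in K$). **Semi-graduation and associated graded objects.** Put $A_k:=$ the $K$-span of $\{x^\alpha\mid \alpha_1+\cdots+\alpha_n=k\}$. Then $A=\bigoplus_{k\ge0}A_k$, $A_0=K$, and $A_pA_q\subseteq A_0\oplus\cdots\oplus A_{p+q}$. $Gr(A)$ is the associated graded ring of the filtration $F_k(A)=A_0\oplus\cdots\oplus A_k$. An $A$-module $M$ is $\mathbb{N}$-semi-graded if $M=\bigoplus_{k\ge 0}M_k$ for additive subgroups $M_k$ with $A_pM_q\subseteq\bigoplus_{0\le k\le p+q}M_k$ for all $p,q\ge 0$. For such $M$, $Gr(M)=\bigoplus_{k\ge0}Gr(M)_k$ with $Gr(M)_k=(M_0\oplus\cdots\oplus M_k)/(M_0\oplus\cdots\oplus M_{k-1})$, a graded $Gr(A)$-module via $\overline{a_p}\cdot\overline{m_q}:=\overline{a_pm_q}\in Gr(M)_{p+q}$ for $a_p\in A_p$, $m_q\in M_q$. The isomorphism $Gr(M)\cong Gr(M')$ is a degree-preserving isomorphism of $Gr(A)$-modules. **Point modules.** A point module for $A$ is an $\mathbb{N}$-semi-graded $A$-module $M=\bigoplus_{k\ge0}M_k$ (each $M_k$ a $K$-subspace) such that $M=Am_0$ for some $m_0\in M_0$ and $\dim_K(M_k)=1$ for all $k\ge 0$. Two point modules $M,M'$ are isomorphic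 if there is an $A$-isomorphism $f:M\to M'$ with $f(M_k)\subseteq M'_k$ for all $k$. $P(A)$ is the collection of isomorphism classes. **The sets $X_m$.** $Gr(A)$ is the multiparameter quantum affine space with presentation $K\{x_1,\dots,x_n\}/\langle x_jx_i-c_{i,j}x_ix_j \mid 1\le i<j\le n\rangle$, all relations being homogeneous of degree $2$. The multilinearization of a homogeneous noncommutative polynomial of degree $d$ replaces each word $x_{v_d}\cdots x_{v_2}x_{v_1}$ by $y_{v_d,d}\cdots y_{v_2,2}y_{v_1,1}$ in commuting variables $y_{v,u}$, and its value at $(p_0,\dots,p_{d-1})$ is obtained by substituting the homogeneous coordinates of $p_{u-1}$ for $(y_{v,u})_v$. Thus for points $p=(p^1:\cdots:p^n)$ and $p'=(p'^1:\cdots:p'^n)$ of $\mathbb{P}^{n-1}$ (projective space over $K$, points given by homogeneous coordinates in $K$), the relation indexed by $i<j$ yields $g_{ij}(p,p')=p'^{\,j}p^{\,i}-c_{i,j}\,p'^{\,i}p^{\,j}$. For $m\ge1$, $$X_m:=\Big\{(p_0,\dots,p_{m-1})\in\prod_{i=0}^{m-1}\mathbb{P}^{n-1}\ \Big|\ g_{ij}(p_k,p_{k+1})=0\ \text{for all } 1\le i<j\le n,\ 0\le k\le m-2\Big\}$$ (so $X_1=\mathbb{P}^{n-1}$). The closed points of $X_m$ are the elements of this set. *)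

theory Defs
  imports "HOL-Algebra.Algebra"
begin

section \<open>Left modules over a not necessarily commutative ring\<close>

text \<open>
  \<^locale>\<open>module\<close> requires a commutative ring of scalars.  The record type
  \<^typ>\<open>('a, 'm) module\<close> is reused; its ring multiplication and ring unit
  are irrelevant here.
\<close>

locale left_module = R?: ring A + M?: abelian_group M
  for A :: "('a, 'c) ring_scheme" (structure) and M :: "('a, 'm, 'd) module_scheme" (structure) +
  assumes lsmult_closed:
      "\<lbrakk>a \<in> carrier A; x \<in> carrier M\<rbrakk> \<Longrightarrow> a \<odot>\<^bsub>M\<^esub> x \<in> carrier M"
    and lsmult_l_distr:
      "\<lbrakk>a \<in> carrier A; b \<in> carrier A; x \<in> carrier M\<rbrakk> \<Longrightarrow>
        (a \<oplus>\<^bsub>A\<^esub> b) \<odot>\<^bsub>M\<^esub> x = a \<odot>\<^bsub>M\<^esub> x \<oplus>\<^bsub>M\<^esub> b \<odot>\<^bsub>M\<^esub> x"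
    and lsmult_r_distr:
      "\<lbrakk>a \<in> carrier A; x \<in> carrier M; y \<in> carrier M\<rbrakk> \<Longrightarrow>
        a \<odot>\<^bsub>M\<^esub> (x \<oplus>\<^bsub>M\<^esub> y) = a \<odot>\<^bsub>M\<^esub> x \<oplus>\<^bsub>M\<^esub> a \<odot>\<^bsub>M\<^esub> y"
    and lsmult_assoc:
      "\<lbrakk>a \<in> carrier A; b \<in> carrier A; x \<in> carrier M\<rbrakk> \<Longrightarrow>
        (a \<otimes>\<^bsub>A\<^esub> b) \<odot>\<^bsub>M\<^esub> x = a \<odot>\<^bsub>M\<^esub> (b \<odot>\<^bsub>M\<^esub> x)"
    and lsmult_one:
      "x \<in> carrier M \<Longrightarrow> \<one>\<^bsub>A\<^esub> \<odot>\<^bsub>M\<^esub> x = x"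

definition regular_module :: "('a, 'c) ring_scheme \<Rightarrow> ('a, 'a) module" where
  "regular_module A =
    \<lparr>carrier = carrier A, monoid.mult = monoid.mult A, one = one A, ring.zero = \<zero>\<^bsub>A\<^esub>, add = add A,
     smult = monoid.mult A\<rparr>"

definition left_module_iso ::
  "('a, 'c) ring_scheme \<Rightarrow> ('a, 'm, 'd) module_scheme \<Rightarrow> ('a, 'l, 'e) module_scheme \<Rightarrow> ('m \<Rightarrow> 'l) set"
where
  "left_module_iso A M N =
    {f \<in> iso (add_monoid M) (add_monoid N).
       \<forall>a \<in> carrier A. \<forall>x \<in> carrier M. f (a \<odot>\<^bsub>M\<^esub> x) = a \<odot>\<^bsub>N\<^esub> f x}"

text \<open>
  \<open>is_free_basis A R M V I e\<close>: the family \<open>(e i)\<close>, \<open>i \<in> I\<close>, of elements of \<open>V\<close> is a basis of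
  the left \<open>R\<close>-submodule \<open>V\<close> of \<open>M\<close>, where \<open>R\<close> is a subring of \<open>A\<close>.
\<close>

definition is_free_basis ::
  "('a, 'c) ring_scheme \<Rightarrow> 'a set \<Rightarrow> ('a, 'm, 'd) module_scheme \<Rightarrow> 'm set \<Rightarrow> 'i set \<Rightarrow> ('i \<Rightarrow> 'm) \<Rightarrow> bool"
where
  "is_free_basis A R M V I e \<longleftrightarrow>
     e ` I \<subseteq> V \<and>
     (\<forall>v \<in> V. \<exists>!f. range f \<subseteq> R \<and> (\<forall>i. i \<notin> I \<longrightarrow> f i = \<zero>\<^bsub>A\<^esub>) \<and> finite {i. f i \<noteq> \<zero>\<^bsub>A\<^esub>} \<and>
        v = (\<Oplus>\<^bsub>M\<^esub> i \<in> {i. f i \<noteq> \<zero>\<^bsub>A\<^esub>}. f i \<odot>\<^bsub>M\<^esub> e i))"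

definition is_subspace ::
  "'a set \<Rightarrow> ('a, 'm, 'd) module_scheme \<Rightarrow> 'm set \<Rightarrow> bool"
where
  "is_subspace K M V \<longleftrightarrow> additive_subgroup V M \<and> (\<forall>r \<in> K. \<forall>v \<in> V. r \<odot>\<^bsub>M\<^esub> v \<in> V)"

definition has_dimension ::
  "('a, 'c) ring_scheme \<Rightarrow> 'a set \<Rightarrow> ('a, 'm, 'd) module_scheme \<Rightarrow> 'm set \<Rightarrow> nat \<Rightarrow> bool"
where
  "has_dimension A K M V d \<longleftrightarrow>
     (\<exists>b. finite b \<and> card b = d \<and> is_free_basis A K M V b (\<lambda>v. v))"


section \<open>Skew PBW extensions\<close>

definition exponents :: "nat \<Rightarrow> (nat \<Rightarrow> nat) set" where
  "exponents n = {\<alpha>. \<forall>i. i \<notin> {1..n} \<longrightarrow> \<alpha> i = 0}"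

primrec pbw_monomial ::
  "('a, 'c) ring_scheme \<Rightarrow> (nat \<Rightarrow> 'a) \<Rightarrow> nat \<Rightarrow> (nat \<Rightarrow> nat) \<Rightarrow> 'a"
where
  "pbw_monomial A x 0 \<alpha> = \<one>\<^bsub>A\<^esub>"
| "pbw_monomial A x (Suc n) \<alpha> = pbw_monomial A x n \<alpha> \<otimes>\<^bsub>A\<^esub> (x (Suc n) [^]\<^bsub>A\<^esub> \<alpha> (Suc n))"

definition affine_span :: "('a, 'c) ring_scheme \<Rightarrow> 'a set \<Rightarrow> nat \<Rightarrow> (nat \<Rightarrow> 'a) \<Rightarrow> 'a set" where
  "affine_span A R n x =
     {r 0 \<oplus>\<^bsub>A\<^esub> (\<Oplus>\<^bsub>A\<^esub> i \<in> {1..n}. r i \<otimes>\<^bsub>A\<^esub> x i) | r. r \<in> {0..n} \<rightarrow> R}"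

text \<open>For \<open>i < j\<close> the constant \<open>c i j\<close> of a skew PBW extension is uniquely determined.\<close>

definition relation_constants ::
  "('a, 'c) ring_scheme \<Rightarrow> 'a set \<Rightarrow> nat \<Rightarrow> (nat \<Rightarrow> 'a) \<Rightarrow> (nat \<Rightarrow> nat \<Rightarrow> 'a) \<Rightarrow> bool"
where
  "relation_constants A R n x c \<longleftrightarrow>
     (\<forall>i \<in> {1..n}. \<forall>j \<in> {1..n}.
        c i j \<in> R - {\<zero>\<^bsub>A\<^esub>} \<and>
        (x j \<otimes>\<^bsub>A\<^esub> x i) \<ominus>\<^bsub>A\<^esub> (c i j \<otimes>\<^bsub>A\<^esub> x i \<otimes>\<^bsub>A\<^esub> x j) \<in> affine_span A R n x)"

locale skew_PBW_extension = ring A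
  for A :: "('a, 'c) ring_scheme" (structure) +
  fixes R :: "'a set" and n :: nat and x :: "nat \<Rightarrow> 'a"
  assumes base_subring: "subring R A"
    and vars_closed: "x \<in> {1..n} \<rightarrow> carrier A"
    and free_on_monomials:
      "is_free_basis A R (regular_module A) (carrier A) (exponents n) (pbw_monomial A x n)"
    and var_scalar:
      "\<lbrakk>i \<in> {1..n}; r \<in> R - {\<zero>}\<rbrakk> \<Longrightarrow> \<exists>c \<in> R - {\<zero>}. (x i \<otimes> r) \<ominus> (c \<otimes> x i) \<in> R"
    and var_var: "\<exists>c. relation_constants A R n x c"

definition skew_derivation ::
  "('a, 'c) ring_scheme \<Rightarrow> ('a \<Rightarrow> 'a) \<Rightarrow> ('a \<Rightarrow> 'a) \<Rightarrow> bool"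
where
  "skew_derivation R \<sigma> \<delta> \<longleftrightarrow>
     \<delta> \<in> carrier R \<rightarrow> carrier R \<and>
     (\<forall>r \<in> carrier R. \<forall>s \<in> carrier R. \<delta> (r \<oplus>\<^bsub>R\<^esub> s) = \<delta> r \<oplus>\<^bsub>R\<^esub> \<delta> s) \<and>
     (\<forall>r \<in> carrier R. \<forall>s \<in> carrier R.
        \<delta> (r \<otimes>\<^bsub>R\<^esub> s) = (\<sigma> r \<otimes>\<^bsub>R\<^esub> \<delta> s) \<oplus>\<^bsub>R\<^esub> (\<delta> r \<otimes>\<^bsub>R\<^esub> s))"

text \<open>
  The data \<open>\<sigma> i\<close>, \<open>\<delta> i\<close> on \<open>R\<close> and the \<open>c i j\<close>, \<open>i < j\<close>, are uniquely determined by the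
  extension, so the existential quantifiers below only name them.
\<close>

definition bijective_skew_PBW_extension ::
  "('a, 'c) ring_scheme \<Rightarrow> 'a set \<Rightarrow> nat \<Rightarrow> (nat \<Rightarrow> 'a) \<Rightarrow> bool"
where
  "bijective_skew_PBW_extension A R n x \<longleftrightarrow>
     skew_PBW_extension A R n x \<and>
     (\<forall>i \<in> {1..n}. \<exists>\<sigma> \<delta>.
        \<sigma> \<in> ring_hom (A\<lparr>carrier := R\<rparr>) (A\<lparr>carrier := R\<rparr>) \<and>
        skew_derivation (A\<lparr>carrier := R\<rparr>) \<sigma> \<delta> \<and>
        (\<forall>r \<in> R. x i \<otimes>\<^bsub>A\<^esub> r = (\<sigma> r \<otimes>\<^bsub>A\<^esub> x i) \<oplus>\<^bsub>A\<^esub> \<delta> r) \<and>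
        bij_betw \<sigma> R R) \<and>
     (\<exists>c. relation_constants A R n x c \<and>
        (\<forall>i \<in> {1..n}. \<forall>j \<in> {1..n}. i < j \<longrightarrow> c i j \<in> Units (A\<lparr>carrier := R\<rparr>)))"

definition central_in :: "'a set \<Rightarrow> ('a, 'c) ring_scheme \<Rightarrow> bool" where
  "central_in K A \<longleftrightarrow> (\<forall>r \<in> K. \<forall>a \<in> carrier A. r \<otimes>\<^bsub>A\<^esub> a = a \<otimes>\<^bsub>A\<^esub> r)"


section \<open>Semi-graduations and associated graded objects\<close>

definition internal_direct_sum :: "('m, 'd) ring_scheme \<Rightarrow> (nat \<Rightarrow> 'm set) \<Rightarrow> bool" where
  "internal_direct_sum M B \<longleftrightarrow>
     (\<forall>k. additive_subgroup (B k) M) \<and>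
     (\<forall>m \<in> carrier M. \<exists>!f. (\<forall>k. f k \<in> B k) \<and> finite {k. f k \<noteq> \<zero>\<^bsub>M\<^esub>} \<and>
        m = (\<Oplus>\<^bsub>M\<^esub> k \<in> {k. f k \<noteq> \<zero>\<^bsub>M\<^esub>}. f k))"

text \<open>
  \<open>filt_below M B k\<close> is the sum of the \<open>B i\<close> with \<open>i < k\<close>, that is \<open>F\<^bsub>k-1\<^esub>\<close>, with \<open>F\<^bsub>-1\<^esub> = 0\<close>.
\<close>

definition filt_below :: "('m, 'd) ring_scheme \<Rightarrow> (nat \<Rightarrow> 'm set) \<Rightarrow> nat \<Rightarrow> 'm set" where
  "filt_below M B k = {\<Oplus>\<^bsub>M\<^esub> i \<in> {..<k}. f i | f. f \<in> (\<Pi> i \<in> {..<k}. B i)}"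

abbreviation filt :: "('m, 'd) ring_scheme \<Rightarrow> (nat \<Rightarrow> 'm set) \<Rightarrow> nat \<Rightarrow> 'm set" where
  "filt M B k \<equiv> filt_below M B (Suc k)"

text \<open>The index set \<open>E\<close> is finite, so the sums over \<open>E\<close> exhaust the whole span.\<close>

definition pbw_piece ::
  "('a, 'c) ring_scheme \<Rightarrow> 'a set \<Rightarrow> nat \<Rightarrow> (nat \<Rightarrow> 'a) \<Rightarrow> nat \<Rightarrow> 'a set"
where
  "pbw_piece A K n x k =
     (let E = {\<alpha> \<in> exponents n. (\<Sum>i = 1..n. \<alpha> i) = k}
      in {\<Oplus>\<^bsub>A\<^esub> \<alpha> \<in> E. f \<alpha> \<otimes>\<^bsub>A\<^esub> pbw_monomial A x n \<alpha> | f. f \<in> E \<rightarrow> K})"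

definition semi_graded_module ::
  "('a, 'c) ring_scheme \<Rightarrow> (nat \<Rightarrow> 'a set) \<Rightarrow> ('a, 'm, 'd) module_scheme \<Rightarrow> (nat \<Rightarrow> 'm set) \<Rightarrow> bool"
where
  "semi_graded_module A AA M MM \<longleftrightarrow>
     left_module A M \<and> internal_direct_sum M MM \<and>
     (\<forall>p q. \<forall>a \<in> AA p. \<forall>m \<in> MM q. a \<odot>\<^bsub>M\<^esub> m \<in> filt M MM (p + q))"

text \<open>
  The group \<open>F\<^sub>k / F\<^bsub>k-1\<^esub>\<close>, as a multiplicatively written monoid of cosets.  The associated graded
  object is the external direct sum of these: its elements are the finitely supported functions
  assigning to each \<open>k\<close> a coset in \<open>F\<^sub>k / F\<^bsub>k-1\<^esub>\<close>.
\<close>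

definition gr_component :: "('m, 'd) ring_scheme \<Rightarrow> (nat \<Rightarrow> 'm set) \<Rightarrow> nat \<Rightarrow> 'm set monoid" where
  "gr_component M B k = (M\<lparr>carrier := filt M B k\<rparr>) A_Mod (filt_below M B k)"

definition gr_carrier :: "('m, 'd) ring_scheme \<Rightarrow> (nat \<Rightarrow> 'm set) \<Rightarrow> (nat \<Rightarrow> 'm set) set" where
  "gr_carrier M B =
     {u. (\<forall>k. u k \<in> carrier (gr_component M B k)) \<and>
         finite {k. u k \<noteq> \<one>\<^bsub>gr_component M B k\<^esub>}}"

definition gr_homogeneous ::
  "('m, 'd) ring_scheme \<Rightarrow> (nat \<Rightarrow> 'm set) \<Rightarrow> nat \<Rightarrow> (nat \<Rightarrow> 'm set) set"
where
  "gr_homogeneous M B k = {u \<in> gr_carrier M B. \<forall>j. j \<noteq> k \<longrightarrow> u j = \<one>\<^bsub>gr_component M B j\<^esub>}"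

definition gr_ring :: "('a, 'c) ring_scheme \<Rightarrow> (nat \<Rightarrow> 'a set) \<Rightarrow> (nat \<Rightarrow> 'a set) ring" where
  "gr_ring A B =
    \<lparr>carrier = gr_carrier A B,
     monoid.mult = (\<lambda>u v k. finprod (gr_component A B k)
               (\<lambda>i. rcoset_mult A (filt_below A B k) (u i) (v (k - i))) {..k}),
     one = (\<lambda>k. if k = 0 then filt_below A B 0 +>\<^bsub>A\<^esub> \<one>\<^bsub>A\<^esub> else filt_below A B k),
     ring.zero = (\<lambda>k. \<one>\<^bsub>gr_component A B k\<^esub>),
     add = (\<lambda>u v k. u k \<otimes>\<^bsub>gr_component A B k\<^esub> v k)\<rparr>"

definition rcoset_smult ::
  "('a, 'm, 'd) module_scheme \<Rightarrow> 'm set \<Rightarrow> 'a set \<Rightarrow> 'm set \<Rightarrow> 'm set"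
where
  "rcoset_smult M N U V = (\<Union>a \<in> U. \<Union>m \<in> V. N +>\<^bsub>M\<^esub> (a \<odot>\<^bsub>M\<^esub> m))"

definition gr_module ::
  "('a, 'm, 'd) module_scheme \<Rightarrow> (nat \<Rightarrow> 'm set) \<Rightarrow> (nat \<Rightarrow> 'a set, nat \<Rightarrow> 'm set) module"
where
  "gr_module M B =
    \<lparr>carrier = gr_carrier M B,
     monoid.mult = undefined, one = undefined,
     ring.zero = (\<lambda>k. \<one>\<^bsub>gr_component M B k\<^esub>),
     add = (\<lambda>u v k. u k \<otimes>\<^bsub>gr_component M B k\<^esub> v k),
     smult = (\<lambda>u v k. finprod (gr_component M B k)
               (\<lambda>i. rcoset_smult M (filt_below M B k) (u i) (v (k - i))) {..k})\<rparr>"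

definition graded_isomorphic ::
  "('a, 'c) ring_scheme \<Rightarrow> ('a, 'm, 'd) module_scheme \<Rightarrow> (nat \<Rightarrow> 'm set) \<Rightarrow>
     ('a, 'l, 'e) module_scheme \<Rightarrow> (nat \<Rightarrow> 'l set) \<Rightarrow> bool"
where
  "graded_isomorphic A M MM N NN \<longleftrightarrow>
     (\<exists>f \<in> left_module_iso A M N. \<forall>k. f ` MM k \<subseteq> NN k)"


section \<open>Point modules\<close>

text \<open>
  A point module is a module together with its semi-graduation.  All point modules with elements
  in a given type \<open>'m\<close> are considered; \<open>'m\<close> is arbitrary.
\<close>

definition point_module ::
  "('a, 'c) ring_scheme \<Rightarrow> 'a set \<Rightarrow> nat \<Rightarrow> (nat \<Rightarrow> 'a) \<Rightarrow> ('a, 'm) module \<Rightarrow> (nat \<Rightarrow> 'm set) \<Rightarrow> bool"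
where
  "point_module A K n x M MM \<longleftrightarrow>
     semi_graded_module A (pbw_piece A K n x) M MM \<and>
     (\<exists>m \<in> MM 0. carrier M = {a \<odot>\<^bsub>M\<^esub> m | a. a \<in> carrier A}) \<and>
     (\<forall>k. is_subspace K M (MM k) \<and> has_dimension A K M (MM k) 1)"

definition point_modules ::
  "('a, 'c) ring_scheme \<Rightarrow> 'a set \<Rightarrow> nat \<Rightarrow> (nat \<Rightarrow> 'a) \<Rightarrow> (('a, 'm) module \<times> (nat \<Rightarrow> 'm set)) set"
where
  "point_modules A K n x = {(M, MM). point_module A K n x M MM}"

definition point_module_iso_rel ::
  "('a, 'c) ring_scheme \<Rightarrow> 'a set \<Rightarrow> nat \<Rightarrow> (nat \<Rightarrow> 'a) \<Rightarrow> (('a, 'm) module \<times> (nat \<Rightarrow> 'm set)) rel"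
where
  "point_module_iso_rel A K n x =
     {((M, MM), (N, NN)). (M, MM) \<in> point_modules A K n x \<and> (N, NN) \<in> point_modules A K n x \<and>
        graded_isomorphic A M MM N NN}"

definition point_module_classes ::
  "('a, 'c) ring_scheme \<Rightarrow> 'a set \<Rightarrow> nat \<Rightarrow> (nat \<Rightarrow> 'a) \<Rightarrow>
     (('a, 'm) module \<times> (nat \<Rightarrow> 'm set)) set set"
where
  "point_module_classes A K n x = point_modules A K n x // point_module_iso_rel A K n x"

definition gr_equiv_rel ::
  "('a, 'c) ring_scheme \<Rightarrow> 'a set \<Rightarrow> nat \<Rightarrow> (nat \<Rightarrow> 'a) \<Rightarrow>
     (('a, 'm) module \<times> (nat \<Rightarrow> 'm set)) set rel"
where
  "gr_equiv_rel A K n x =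
     {(P, Q). P \<in> point_module_classes A K n x \<and> Q \<in> point_module_classes A K n x \<and>
        (\<exists>(M, MM) \<in> P. \<exists>(N, NN) \<in> Q.
           graded_isomorphic (gr_ring A (pbw_piece A K n x))
             (gr_module M MM) (gr_homogeneous M MM) (gr_module N NN) (gr_homogeneous N NN))}"


section \<open>Projective space and the sets X_m\<close>

definition nonzero_vectors :: "('a, 'c) ring_scheme \<Rightarrow> 'a set \<Rightarrow> nat \<Rightarrow> (nat \<Rightarrow> 'a) set" where
  "nonzero_vectors A K n = {v \<in> {1..n} \<rightarrow>\<^sub>E K. \<exists>i \<in> {1..n}. v i \<noteq> \<zero>\<^bsub>A\<^esub>}"

definition projective_points :: "('a, 'c) ring_scheme \<Rightarrow> 'a set \<Rightarrow> nat \<Rightarrow> (nat \<Rightarrow> 'a) set set" where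
  "projective_points A K n =
     nonzero_vectors A K n //
       {(v, w). v \<in> nonzero_vectors A K n \<and> w \<in> nonzero_vectors A K n \<and>
          (\<exists>l \<in> K - {\<zero>\<^bsub>A\<^esub>}. \<forall>i \<in> {1..n}. w i = l \<otimes>\<^bsub>A\<^esub> v i)}"

text \<open>
  The multilinearization of \<open>x\<^sub>j x\<^sub>i - c\<^bsub>i,j\<^esub> x\<^sub>i x\<^sub>j\<close>: the left letter of each word is
  evaluated at \<open>w\<close>, the right letter at \<open>v\<close>.
\<close>

definition multilin_relation ::
  "('a, 'c) ring_scheme \<Rightarrow> (nat \<Rightarrow> nat \<Rightarrow> 'a) \<Rightarrow> nat \<Rightarrow> nat \<Rightarrow> (nat \<Rightarrow> 'a) \<Rightarrow> (nat \<Rightarrow> 'a) \<Rightarrow> 'a"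
where
  "multilin_relation A c i j v w =
     (w j \<otimes>\<^bsub>A\<^esub> v i) \<ominus>\<^bsub>A\<^esub> (c i j \<otimes>\<^bsub>A\<^esub> w i \<otimes>\<^bsub>A\<^esub> v j)"

definition X_set ::
  "('a, 'c) ring_scheme \<Rightarrow> 'a set \<Rightarrow> nat \<Rightarrow> (nat \<Rightarrow> nat \<Rightarrow> 'a) \<Rightarrow> nat \<Rightarrow> (nat \<Rightarrow> (nat \<Rightarrow> 'a) set) set"
where
  "X_set A K n c m =
     {p \<in> {..<m} \<rightarrow>\<^sub>E projective_points A K n.
        \<forall>i \<in> {1..n}. \<forall>j \<in> {1..n}. i < j \<longrightarrow>
          (\<forall>k. k + 1 < m \<longrightarrow>
             (\<forall>v \<in> p k. \<forall>w \<in> p (k + 1). multilin_relation A c i j v w = \<zero>\<^bsub>A\<^esub>))}"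

end

theory Submission
  imports Defs
begin

text \<open>
  The injection already exists for \<open>m\<^sub>0 = 1\<close>, where \<open>X\<^sub>1\<close> is the whole projective space.

  Let \<open>M\<close> be a point module.  Every graded component of \<open>Gr(M)\<close> is a line, and if \<open>e\<^sub>k\<close> spans the line in
  degree \<open>k\<close>, the variables act by \<open>x\<^sub>i e\<^sub>k = v\<^sub>k\<^sub>,\<^sub>i e\<^sub>k\<^sub>+\<^sub>1\<close>.  The vector \<open>v\<^sub>k\<close> is never zero: otherwise the part
  of \<open>M\<close> of degree at most \<open>k\<close> would be a submodule containing the generator, although \<open>M\<close> has nonzero
  components in all degrees (\<open>var_raises_degree\<close>).  So \<open>M\<close> defines points \<open>p\<^sub>0, p\<^sub>1, \<dots>\<close> of projective
  space, and \<open>p\<^sub>0\<close>, here called \<open>point_coords\<close>, is the value of the injection at the class of \<open>M\<close>.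

  The relations of \<open>Gr(A)\<close> say \<open>v\<^sub>k\<^sub>+\<^sub>1\<^sub>,\<^sub>j v\<^sub>k\<^sub>,\<^sub>i = c\<^sub>i\<^sub>j v\<^sub>k\<^sub>+\<^sub>1\<^sub>,\<^sub>i v\<^sub>k\<^sub>,\<^sub>j\<close>.  Choosing \<open>i\<close> with \<open>v\<^sub>k\<^sub>,\<^sub>i\<close> nonzero, one sees that
  \<open>v\<^sub>k\<^sub>+\<^sub>1\<close> is determined by \<open>v\<^sub>k\<close> up to a scalar (\<open>leading_coords_next\<close>).  Thus \<open>p\<^sub>0\<close> determines the whole
  sequence, hence the action of all monomials on \<open>Gr(M)\<close>, hence \<open>Gr(M)\<close> up to graded isomorphism.
  Conversely, a graded isomorphism of associated graded modules, or of point modules, preserves \<open>p\<^sub>0\<close>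
  (\<open>gr_isomorphism_leading_coords\<close>, \<open>isomorphism_leading_coords\<close>).  Therefore the equivalence of
  the theorem is exactly equality of \<open>p\<^sub>0\<close> (\<open>gr_isomorphic_iff_point_coords_eq\<close>).

  The action of the variables on \<open>Gr(M)\<close> is computed in \<open>M\<close> itself, by congruences modulo the filtration step \<open>F k\<close> spanned by
  the components of degree less than \<open>k\<close>.
\<close>

section \<open>Congruences modulo subgroups and filtrations\<close>

lemma (in abelian_group) r_coset_eq_iff:
  assumes "additive_subgroup H G" "u \<in> carrier G" "v \<in> carrier G"
  shows "H +> u = H +> v \<longleftrightarrow> u \<ominus> v \<in> H"
proof
  assume "H +> u = H +> v"
  moreover have "u \<in> H +> u"
    using additive_subgroup.zero_closed[OF assms(1)] assms(2) by (force simp: a_r_coset_def')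
  ultimately obtain h where "h \<in> H" "u = h \<oplus> v" by (auto simp: a_r_coset_def')
  then show "u \<ominus> v \<in> H"
    using assms(3) additive_subgroup.a_Hcarr[OF assms(1)]
    by (simp add: a_minus_def a_assoc r_neg)
next
  assume h: "u \<ominus> v \<in> H"
  have "u = (u \<ominus> v) \<oplus> v" using assms by (simp add: a_minus_def a_assoc l_neg)
  then have "u \<in> H +> v" using h by (auto simp: a_r_coset_def')
  then show "H +> u = H +> v"
    using a_repr_independence[of u H v] assms additive_subgroup.a_subgroup[OF assms(1)] by simp
qed

lemma (in abelian_group) subgroup_minus_closed:
  assumes "additive_subgroup H G" "u \<in> H" "v \<in> H"
  shows "u \<ominus> v \<in> H"
  unfolding a_minus_def
  by (intro additive_subgroup.a_closed[OF assms(1)] additive_subgroup.a_inv_closed[OF assms(1)] assms)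

lemma (in abelian_group) cong_add:
  assumes "additive_subgroup H G" "u \<ominus> v \<in> H" "u' \<ominus> v' \<in> H"
    "u \<in> carrier G" "v \<in> carrier G" "u' \<in> carrier G" "v' \<in> carrier G"
  shows "(u \<oplus> u') \<ominus> (v \<oplus> v') \<in> H"
proof -
  have "(u \<oplus> u') \<ominus> (v \<oplus> v') = (u \<ominus> v) \<oplus> (u' \<ominus> v')"
    using assms by (simp add: a_minus_def minus_add a_ac)
  then show ?thesis using assms additive_subgroup.a_closed by metis
qed

lemma (in abelian_group) cong_minus:
  assumes "additive_subgroup H G" "u \<ominus> v \<in> H" "u' \<ominus> v' \<in> H"
    "u \<in> carrier G" "v \<in> carrier G" "u' \<in> carrier G" "v' \<in> carrier G"
  shows "(u \<ominus> u') \<ominus> (v \<ominus> v') \<in> H"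
proof -
  have "(u \<ominus> u') \<ominus> (v \<ominus> v') = (u \<ominus> v) \<ominus> (u' \<ominus> v')"
    using assms by (simp add: a_minus_def minus_add a_ac)
  then show ?thesis using assms subgroup_minus_closed by metis
qed

lemma (in abelian_group) cong_trans:
  assumes "additive_subgroup H G" "u \<ominus> v \<in> H" "v \<ominus> w \<in> H"
    "u \<in> carrier G" "v \<in> carrier G" "w \<in> carrier G"
  shows "u \<ominus> w \<in> H"
proof -
  have "u \<ominus> w = (u \<ominus> v) \<oplus> (v \<ominus> w)"
    using assms by (simp add: a_minus_def a_assoc r_neg1 r_neg2)
  then show ?thesis using assms additive_subgroup.a_closed by metis
qed

lemma (in abelian_group) cong_mem:
  assumes "additive_subgroup H G" "u \<ominus> v \<in> H" "u \<in> carrier G" "v \<in> carrier G"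
  shows "u \<in> H \<longleftrightarrow> v \<in> H"
proof
  assume "v \<in> H"
  moreover have "u = (u \<ominus> v) \<oplus> v"
    using assms by (simp add: a_minus_def a_assoc l_neg)
  ultimately show "u \<in> H" using assms additive_subgroup.a_closed by metis
next
  assume "u \<in> H"
  moreover have "v = u \<ominus> (u \<ominus> v)"
    using assms by (simp add: a_minus_def minus_add r_neg1 r_neg2)
  ultimately show "v \<in> H" using assms subgroup_minus_closed by metis
qed

lemma (in abelian_monoid) finsum_mem:
  assumes "\<zero> \<in> S" "S \<subseteq> carrier G" "\<And>u v. u \<in> S \<Longrightarrow> v \<in> S \<Longrightarrow> u \<oplus> v \<in> S"
    "\<And>i. i \<in> I \<Longrightarrow> f i \<in> S"
  shows "finsum G f I \<in> S"
  using assms(4)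
proof (induct I rule: infinite_finite_induct)
  case (insert i I)
  then have "f \<in> I \<rightarrow> carrier G" "f i \<in> carrier G" using assms(2) by auto
  then show ?case using insert assms(3) by simp
qed (use assms(1) in simp_all)

lemma (in abelian_monoid) filt_below_0: "filt_below G B 0 = {\<zero>}"
  by (auto simp: filt_below_def)

text \<open>
  This recursion replaces the explicit finite sums: every later statement about the filtration is
  proved by induction on its index.
\<close>

lemma (in abelian_monoid) filt_below_Suc:
  assumes "\<And>k. B k \<subseteq> carrier G"
  shows "filt_below G B (Suc k) = {b \<oplus> s | b s. b \<in> B k \<and> s \<in> filt_below G B k}"
proof -
  have split: "(\<Oplus>i \<in> {..<Suc k}. f i) = f k \<oplus> (\<Oplus>i \<in> {..<k}. f i)"
    if "f \<in> (\<Pi> i \<in> {..<Suc k}. B i)" for f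
  proof -
    have "f i \<in> carrier G" if "i \<le> k" for i
      using that \<open>f \<in> _\<close> assms[of i] by (auto simp: Pi_def less_Suc_eq_le)
    then show ?thesis unfolding lessThan_Suc by (subst finsum_insert) auto
  qed
  show ?thesis
  proof (intro equalityI subsetI)
    fix m assume "m \<in> filt_below G B (Suc k)"
    then obtain f where f: "f \<in> (\<Pi> i \<in> {..<Suc k}. B i)" "m = (\<Oplus>i \<in> {..<Suc k}. f i)"
      unfolding filt_below_def by blast
    have "f k \<in> B k" "(\<Oplus>i \<in> {..<k}. f i) \<in> filt_below G B k"
      using f(1) unfolding filt_below_def by (auto intro!: exI[of _ f])
    then show "m \<in> {b \<oplus> s | b s. b \<in> B k \<and> s \<in> filt_below G B k}"
      using f(2) split[OF f(1)] by blast
  next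
    fix m assume "m \<in> {b \<oplus> s | b s. b \<in> B k \<and> s \<in> filt_below G B k}"
    then obtain b f where f: "b \<in> B k" "f \<in> (\<Pi> i \<in> {..<k}. B i)" "m = b \<oplus> (\<Oplus>i \<in> {..<k}. f i)"
      unfolding filt_below_def by blast
    let ?g = "f(k := b)"
    have g: "?g \<in> (\<Pi> i \<in> {..<Suc k}. B i)" using f by (auto simp: less_Suc_eq)
    have "f i \<in> carrier G" if "i < k" for i
      using that f(2) assms[of i] by (auto simp: Pi_def)
    then have "(\<Oplus>i \<in> {..<k}. ?g i) = (\<Oplus>i \<in> {..<k}. f i)"
      by (intro finsum_cong') auto
    then have "m = (\<Oplus>i \<in> {..<Suc k}. ?g i)" using split[OF g] f(3) by simp
    then show "m \<in> filt_below G B (Suc k)" using g unfolding filt_below_def by blast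
  qed
qed

section \<open>Semi-graded modules\<close>

context left_module
begin

lemma zero_smult: "u \<in> carrier M \<Longrightarrow> \<zero> \<odot>\<^bsub>M\<^esub> u = \<zero>\<^bsub>M\<^esub>"
  by (metis M.add.l_cancel_one M.r_zero R.l_zero R.zero_closed lsmult_closed lsmult_l_distr)

lemma smult_zero: "a \<in> carrier A \<Longrightarrow> a \<odot>\<^bsub>M\<^esub> \<zero>\<^bsub>M\<^esub> = \<zero>\<^bsub>M\<^esub>"
  by (metis M.add.l_cancel_one M.r_zero M.zero_closed lsmult_closed lsmult_r_distr)

lemma smult_neg: "a \<in> carrier A \<Longrightarrow> u \<in> carrier M \<Longrightarrow> a \<odot>\<^bsub>M\<^esub> (\<ominus>\<^bsub>M\<^esub> u) = \<ominus>\<^bsub>M\<^esub> (a \<odot>\<^bsub>M\<^esub> u)"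
  by (metis M.a_inv_closed M.l_neg M.minus_equality lsmult_closed lsmult_r_distr smult_zero)

lemma neg_smult: "a \<in> carrier A \<Longrightarrow> u \<in> carrier M \<Longrightarrow> (\<ominus> a) \<odot>\<^bsub>M\<^esub> u = \<ominus>\<^bsub>M\<^esub> (a \<odot>\<^bsub>M\<^esub> u)"
  by (metis M.minus_equality R.a_inv_closed R.l_neg lsmult_closed lsmult_l_distr zero_smult)

lemma smult_minus:
  "a \<in> carrier A \<Longrightarrow> u \<in> carrier M \<Longrightarrow> v \<in> carrier M \<Longrightarrow>
    a \<odot>\<^bsub>M\<^esub> (u \<ominus>\<^bsub>M\<^esub> v) = a \<odot>\<^bsub>M\<^esub> u \<ominus>\<^bsub>M\<^esub> a \<odot>\<^bsub>M\<^esub> v"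
  by (simp add: a_minus_def lsmult_r_distr smult_neg)

lemma minus_smult:
  "a \<in> carrier A \<Longrightarrow> b \<in> carrier A \<Longrightarrow> u \<in> carrier M \<Longrightarrow>
    (a \<ominus> b) \<odot>\<^bsub>M\<^esub> u = a \<odot>\<^bsub>M\<^esub> u \<ominus>\<^bsub>M\<^esub> b \<odot>\<^bsub>M\<^esub> u"
  by (simp add: a_minus_def lsmult_l_distr neg_smult)

end

text \<open>
  The filtrations \<open>B\<close> of \<open>A\<close> and \<open>F\<close> of \<open>M\<close> below are indexed so that step \<open>k\<close> contains the
  components of degree less than \<open>k\<close>.  Thus elements of degree at most \<open>k\<close> form \<open>F (Suc k)\<close>, and
  \<open>F (Suc k) / F k\<close> is the component of degree \<open>k\<close> of \<open>Gr(M)\<close>.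
\<close>

locale semi_graded = left_module A M
  for A :: "('a, 'c) ring_scheme" (structure) and M :: "('a, 'm, 'd) module_scheme" (structure) +
  fixes AA :: "nat \<Rightarrow> 'a set" and MM :: "nat \<Rightarrow> 'm set"
  assumes piece_closed: "AA p \<subseteq> carrier A"
    and zero_in_piece: "\<zero> \<in> AA p"
    and direct: "internal_direct_sum M MM"
    and smult_piece: "\<lbrakk>a \<in> AA p; m \<in> MM q\<rbrakk> \<Longrightarrow> a \<odot>\<^bsub>M\<^esub> m \<in> filt M MM (p + q)"
begin

abbreviation B where "B \<equiv> filt_below A AA"
abbreviation F where "F \<equiv> filt_below M MM"

lemma component_subgroup: "additive_subgroup (MM k) M"
  using direct by (simp add: internal_direct_sum_def)

lemma component_closed: "MM k \<subseteq> carrier M"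
  by (rule additive_subgroup.a_subset[OF component_subgroup])

lemma component_mem: "u \<in> MM k \<Longrightarrow> u \<in> carrier M"
  using component_closed by blast

lemma piece_mem: "a \<in> AA p \<Longrightarrow> a \<in> carrier A"
  using piece_closed by blast

lemma B_0: "B 0 = {\<zero>}" by (rule R.filt_below_0)
lemma F_0: "F 0 = {\<zero>\<^bsub>M\<^esub>}" by (rule M.filt_below_0)
lemmas B_Suc = R.filt_below_Suc[of AA, OF piece_closed]
lemmas F_Suc = M.filt_below_Suc[of MM, OF component_closed]

lemma F_subgroup: "additive_subgroup (F k) M"
proof (induct k)
  case 0
  show ?case by (simp add: F_0 additive_subgroup_def M.add.triv_subgroup)
next
  case (Suc k)
  have "F (Suc k) = MM k <+>\<^bsub>M\<^esub> F k" by (auto simp: F_Suc set_add_def')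
  then show ?case using M.add_additive_subgroups[OF component_subgroup Suc] by simp
qed

lemma F_closed: "F k \<subseteq> carrier M"
  by (rule additive_subgroup.a_subset[OF F_subgroup])

lemma F_mem: "u \<in> F k \<Longrightarrow> u \<in> carrier M"
  using F_closed by blast

lemma zero_F: "\<zero>\<^bsub>M\<^esub> \<in> F k"
  by (rule additive_subgroup.zero_closed[OF F_subgroup])

lemma add_F: "u \<in> F k \<Longrightarrow> v \<in> F k \<Longrightarrow> u \<oplus>\<^bsub>M\<^esub> v \<in> F k"
  by (rule additive_subgroup.a_closed[OF F_subgroup])

lemma neg_F: "u \<in> F k \<Longrightarrow> \<ominus>\<^bsub>M\<^esub> u \<in> F k"
  by (rule additive_subgroup.a_inv_closed[OF F_subgroup])

lemma minus_F: "u \<in> F k \<Longrightarrow> v \<in> F k \<Longrightarrow> u \<ominus>\<^bsub>M\<^esub> v \<in> F k"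
  by (rule M.subgroup_minus_closed[OF F_subgroup])

lemma F_step: "F k \<subseteq> F (Suc k)"
proof
  fix u assume u: "u \<in> F k"
  then have "u = \<zero>\<^bsub>M\<^esub> \<oplus>\<^bsub>M\<^esub> u" by (simp add: F_mem)
  then show "u \<in> F (Suc k)"
    using u additive_subgroup.zero_closed[OF component_subgroup] unfolding F_Suc by blast
qed

lemma F_mono: "k \<le> l \<Longrightarrow> F k \<subseteq> F l"
  by (rule lift_Suc_mono_le[of F, OF F_step])

lemma component_F: "MM k \<subseteq> F (Suc k)"
proof
  fix u assume u: "u \<in> MM k"
  then have "u = u \<oplus>\<^bsub>M\<^esub> \<zero>\<^bsub>M\<^esub>" by (simp add: component_mem)
  then show "u \<in> F (Suc k)" using u zero_F unfolding F_Suc by blast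
qed

lemma F_1: "F (Suc 0) = MM 0"
proof (intro equalityI subsetI)
  fix u assume "u \<in> F (Suc 0)"
  then show "u \<in> MM 0" using component_closed[of 0] by (auto simp: F_Suc F_0)
qed (use component_F in blast)

text \<open>
  An element of \<open>MM k \<inter> F k\<close> has two expansions into homogeneous parts, one concentrated in degree
  \<open>k\<close> and one in lower degrees; in a direct sum they can only agree if both are zero.
\<close>

lemma component_Int_F:
  assumes "u \<in> MM k" "u \<in> F k"
  shows "u = \<zero>\<^bsub>M\<^esub>"
proof -
  obtain f where f: "f \<in> (\<Pi> i \<in> {..<k}. MM i)" "u = (\<Oplus>\<^bsub>M\<^esub> i \<in> {..<k}. f i)"
    using assms(2) unfolding filt_below_def by blast
  define g where "g i = (if i < k then f i else \<zero>\<^bsub>M\<^esub>)" for i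
  define h where "h i = (if i = k then u else \<zero>\<^bsub>M\<^esub>)" for i
  have zero: "\<zero>\<^bsub>M\<^esub> \<in> MM i" for i by (rule additive_subgroup.zero_closed[OF component_subgroup])
  have g_mem: "g i \<in> MM i" for i using f(1) zero by (auto simp: g_def)
  have h_mem: "h i \<in> MM i" for i using assms(1) zero by (auto simp: h_def)
  have f_carrier: "f i \<in> carrier M" if "i < k" for i
    using f(1) that component_mem[of "f i" i] by auto
  have g_carrier: "g i \<in> carrier M" and h_carrier: "h i \<in> carrier M" for i
    using g_mem h_mem component_closed by blast+
  have fin: "finite {i. g i \<noteq> \<zero>\<^bsub>M\<^esub>}" "finite {i. h i \<noteq> \<zero>\<^bsub>M\<^esub>}"
    by (rule finite_subset[of _ "{..k}"]; auto simp: g_def h_def)+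
  have "(\<Oplus>\<^bsub>M\<^esub> i \<in> {i. g i \<noteq> \<zero>\<^bsub>M\<^esub>}. g i) = (\<Oplus>\<^bsub>M\<^esub> i \<in> {..<k}. g i)"
    by (rule M.add.finprod_mono_neutral_cong_left) (auto simp: g_def f_carrier)
  also have "\<dots> = u" unfolding f(2)
    by (rule M.finsum_cong') (auto simp: g_def f_carrier)
  finally have "u = (\<Oplus>\<^bsub>M\<^esub> i \<in> {i. g i \<noteq> \<zero>\<^bsub>M\<^esub>}. g i)" by simp
  moreover have "(\<Oplus>\<^bsub>M\<^esub> i \<in> {i. h i \<noteq> \<zero>\<^bsub>M\<^esub>}. h i) = (\<Oplus>\<^bsub>M\<^esub> i \<in> {k}. h i)"
    by (rule M.add.finprod_mono_neutral_cong_left) (use component_mem[OF assms(1)] in \<open>auto simp: h_def split: if_splits\<close>)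
  then have "u = (\<Oplus>\<^bsub>M\<^esub> i \<in> {i. h i \<noteq> \<zero>\<^bsub>M\<^esub>}. h i)"
    using h_carrier[of k] by (simp add: h_def)
  moreover have "\<exists>!f. (\<forall>k. f k \<in> MM k) \<and> finite {k. f k \<noteq> \<zero>\<^bsub>M\<^esub>} \<and>
        u = (\<Oplus>\<^bsub>M\<^esub> k \<in> {k. f k \<noteq> \<zero>\<^bsub>M\<^esub>}. f k)"
    using direct assms(1) component_closed unfolding internal_direct_sum_def by blast
  ultimately have "g = h" using g_mem h_mem fin by blast
  then have "g k = h k" by simp
  then show ?thesis by (simp add: g_def h_def)
qed

lemma B_closed: "B p \<subseteq> carrier A"
proof (induct p)
  case (Suc p)
  then show ?case using piece_closed[of p] by (auto simp: B_Suc)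
qed (simp add: B_0)

lemma zero_B: "\<zero> \<in> B p"
proof (induct p)
  case (Suc p)
  moreover have "\<zero> = \<zero> \<oplus> \<zero>" by simp
  ultimately show ?case using zero_in_piece[of p] unfolding B_Suc by blast
qed (simp add: B_0)

lemma piece_B: "AA p \<subseteq> B (Suc p)"
proof
  fix a assume "a \<in> AA p"
  moreover from this have "a = a \<oplus> \<zero>" by (simp add: piece_mem)
  ultimately show "a \<in> B (Suc p)" using zero_B unfolding B_Suc by blast
qed

lemma B_mem: "a \<in> B p \<Longrightarrow> a \<in> carrier A"
  using B_closed by blast

text \<open>
  The following lemmas say that multiplication is additive on degrees, and that lowering the degree
  of either factor by one lowers the degree of the product by one.  The latter makes products of
  cosets in \<open>Gr\<close> well defined.
\<close>

lemma piece_smult_F: "a \<in> AA p \<Longrightarrow> u \<in> F q \<Longrightarrow> a \<odot>\<^bsub>M\<^esub> u \<in> F (p + q)"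
proof (induct q arbitrary: u)
  case 0
  then show ?case by (simp add: F_0 piece_mem smult_zero zero_F)
next
  case (Suc q)
  then obtain b s where b: "b \<in> MM q" "s \<in> F q" "u = b \<oplus>\<^bsub>M\<^esub> s" by (auto simp: F_Suc)
  have "a \<odot>\<^bsub>M\<^esub> u = a \<odot>\<^bsub>M\<^esub> b \<oplus>\<^bsub>M\<^esub> a \<odot>\<^bsub>M\<^esub> s"
    unfolding b(3) using Suc.prems(1) b piece_closed component_closed F_mem by (intro lsmult_r_distr) auto
  then show ?case
    using smult_piece[OF Suc.prems(1) b(1)] Suc.hyps[OF Suc.prems(1) b(2)] F_step[of "p + q"]
    by (simp add: add_F subset_iff)
qed

lemma B_smult_F: "a \<in> B p \<Longrightarrow> u \<in> F (Suc q) \<Longrightarrow> a \<odot>\<^bsub>M\<^esub> u \<in> F (p + q)"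
proof (induct p arbitrary: a)
  case 0
  then show ?case using zero_smult zero_F F_mem by (auto simp: B_0)
next
  case (Suc p)
  then obtain b s where b: "b \<in> AA p" "s \<in> B p" "a = b \<oplus> s" by (auto simp: B_Suc)
  have "a \<odot>\<^bsub>M\<^esub> u = b \<odot>\<^bsub>M\<^esub> u \<oplus>\<^bsub>M\<^esub> s \<odot>\<^bsub>M\<^esub> u"
    unfolding b(3) using Suc.prems b piece_closed B_mem F_mem by (intro lsmult_l_distr) auto
  then show ?case
    using piece_smult_F[OF b(1) Suc.prems(2)] Suc.hyps[OF b(2) Suc.prems(2)] F_step[of "p + q"]
    by (simp add: add_F subset_iff)
qed

lemma B_Suc_smult_F: "a \<in> B (Suc p) \<Longrightarrow> u \<in> F q \<Longrightarrow> a \<odot>\<^bsub>M\<^esub> u \<in> F (p + q)"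
  by (cases q) (use B_smult_F[of a "Suc p"] B_mem smult_zero zero_F in \<open>auto simp: F_0\<close>)

lemma B_Suc_smult_F_Suc: "a \<in> B (Suc p) \<Longrightarrow> u \<in> F (Suc q) \<Longrightarrow> a \<odot>\<^bsub>M\<^esub> u \<in> F (Suc (p + q))"
  using B_Suc_smult_F[of a p u "Suc q"] by simp

end

section \<open>Associated graded objects\<close>

lemma gr_component_carrier:
  "carrier (gr_component G B k) = {filt_below G B k +>\<^bsub>G\<^esub> u | u. u \<in> filt G B k}"
  by (auto simp: gr_component_def A_FactGroup_def FactGroup_def RCOSETS_def a_r_coset_def r_coset_def)

lemma gr_component_one: "\<one>\<^bsub>gr_component G B k\<^esub> = filt_below G B k"
  by (simp add: gr_component_def A_FactGroup_def FactGroup_def)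

lemma gr_component_mult: "U \<otimes>\<^bsub>gr_component G B k\<^esub> V = U <+>\<^bsub>G\<^esub> V"
  by (simp add: gr_component_def A_FactGroup_def FactGroup_def set_add_def set_mult_def)

text \<open>
  The image in \<open>Gr\<close> of an element \<open>u\<close> of degree at most \<open>k\<close>, placed in degree \<open>k\<close>.
\<close>

definition gr_elem :: "('m, 'd) ring_scheme \<Rightarrow> (nat \<Rightarrow> 'm set) \<Rightarrow> nat \<Rightarrow> 'm \<Rightarrow> nat \<Rightarrow> 'm set" where
  "gr_elem G B k u = (\<lambda>j. filt_below G B j +>\<^bsub>G\<^esub> (if j = k then u else \<zero>\<^bsub>G\<^esub>))"

lemma (in abelian_group) gr_elem_homogeneous:
  assumes "\<And>j. filt_below G B j \<subseteq> carrier G" "\<And>j. \<zero> \<in> filt_below G B j" "u \<in> filt G B k"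
  shows "gr_elem G B k u \<in> gr_homogeneous G B k"
proof -
  have one: "gr_elem G B k u j = \<one>\<^bsub>gr_component G B j\<^esub>" if "j \<noteq> k" for j
    using that assms(1)[of j] by (simp add: gr_elem_def gr_component_one)
  then have "{j. gr_elem G B k u j \<noteq> \<one>\<^bsub>gr_component G B j\<^esub>} \<subseteq> {k}" by blast
  then have "finite {j. gr_elem G B k u j \<noteq> \<one>\<^bsub>gr_component G B j\<^esub>}"
    by (rule finite_subset) simp
  moreover have "gr_elem G B k u j \<in> carrier (gr_component G B j)" for j
    using assms(2)[of "Suc j"] assms(3) unfolding gr_elem_def gr_component_carrier
    by (cases "j = k") auto
  ultimately show ?thesis using one by (simp add: gr_homogeneous_def gr_carrier_def)
qed

context semi_graded
begin

abbreviation G where "G \<equiv> gr_component M MM"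

lemma coset_eq_iff:
  "u \<in> carrier M \<Longrightarrow> v \<in> carrier M \<Longrightarrow> F k +>\<^bsub>M\<^esub> u = F k +>\<^bsub>M\<^esub> v \<longleftrightarrow> u \<ominus>\<^bsub>M\<^esub> v \<in> F k"
  by (rule M.r_coset_eq_iff[OF F_subgroup])

lemma coset_zero: "F k +>\<^bsub>M\<^esub> \<zero>\<^bsub>M\<^esub> = F k"
  by (rule M.a_coset_add_zero[OF F_closed])

lemma G_elemE:
  assumes "U \<in> carrier (G k)"
  obtains u where "u \<in> F (Suc k)" "U = F k +>\<^bsub>M\<^esub> u"
  using assms by (auto simp: gr_component_carrier)

lemma G_elemI: "u \<in> F (Suc k) \<Longrightarrow> F k +>\<^bsub>M\<^esub> u \<in> carrier (G k)"
  by (auto simp: gr_component_carrier)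

lemma G_mult:
  assumes "u \<in> carrier M" "v \<in> carrier M"
  shows "(F k +>\<^bsub>M\<^esub> u) \<otimes>\<^bsub>G k\<^esub> (F k +>\<^bsub>M\<^esub> v) = F k +>\<^bsub>M\<^esub> (u \<oplus>\<^bsub>M\<^esub> v)"
proof -
  interpret H: abelian_subgroup "F k" M
    by (rule abelian_subgroupI3[OF F_subgroup M.abelian_group_axioms])
  show ?thesis unfolding gr_component_mult by (rule H.a_rcos_sum[OF assms])
qed

lemma comm_group_G: "comm_group (G k)"
proof (rule comm_groupI)
  show "\<one>\<^bsub>G k\<^esub> \<in> carrier (G k)"
    using G_elemI[OF zero_F] by (simp add: gr_component_one coset_zero)
next
  fix U V assume UV: "U \<in> carrier (G k)" "V \<in> carrier (G k)"
  obtain u where u: "u \<in> F (Suc k)" "U = F k +>\<^bsub>M\<^esub> u" using UV(1) by (rule G_elemE)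
  obtain v where v: "v \<in> F (Suc k)" "V = F k +>\<^bsub>M\<^esub> v" using UV(2) by (rule G_elemE)
  note uv = u v
  show "U \<otimes>\<^bsub>G k\<^esub> V \<in> carrier (G k)" using uv by (simp add: G_mult F_mem G_elemI add_F)
  show "U \<otimes>\<^bsub>G k\<^esub> V = V \<otimes>\<^bsub>G k\<^esub> U" using uv by (simp add: G_mult F_mem M.a_comm)
  fix W assume "W \<in> carrier (G k)"
  then obtain w where "w \<in> F (Suc k)" "W = F k +>\<^bsub>M\<^esub> w" by (rule G_elemE)
  then show "U \<otimes>\<^bsub>G k\<^esub> V \<otimes>\<^bsub>G k\<^esub> W = U \<otimes>\<^bsub>G k\<^esub> (V \<otimes>\<^bsub>G k\<^esub> W)"
    using uv by (simp add: G_mult F_mem M.a_assoc)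
next
  fix U assume "U \<in> carrier (G k)"
  then obtain u where u: "u \<in> F (Suc k)" "U = F k +>\<^bsub>M\<^esub> u" by (rule G_elemE)
  show "\<one>\<^bsub>G k\<^esub> \<otimes>\<^bsub>G k\<^esub> U = U"
    using u G_mult[of "\<zero>\<^bsub>M\<^esub>" u k] by (simp add: gr_component_one coset_zero F_mem)
  have "(F k +>\<^bsub>M\<^esub> (\<ominus>\<^bsub>M\<^esub> u)) \<otimes>\<^bsub>G k\<^esub> U = \<one>\<^bsub>G k\<^esub>"
    using u by (simp add: G_mult F_mem M.l_neg gr_component_one coset_zero)
  then show "\<exists>V \<in> carrier (G k). V \<otimes>\<^bsub>G k\<^esub> U = \<one>\<^bsub>G k\<^esub>"
    using G_elemI[OF neg_F[OF u(1)]] by blast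
qed

text \<open>
  Changing the representatives by \<open>b\<close> and \<open>s\<close> of smaller degree changes the product by three terms,
  each of which has a factor of smaller degree and therefore lies in \<open>F (p + q)\<close>.
\<close>

lemma rcoset_smult_cosets:
  assumes a: "a \<in> B (Suc p)" and u: "u \<in> F (Suc q)"
  shows "rcoset_smult M (F (p + q)) (B p +>\<^bsub>A\<^esub> a) (F q +>\<^bsub>M\<^esub> u) = F (p + q) +>\<^bsub>M\<^esub> (a \<odot>\<^bsub>M\<^esub> u)"
proof -
  have "F (p + q) +>\<^bsub>M\<^esub> ((b \<oplus> a) \<odot>\<^bsub>M\<^esub> (s \<oplus>\<^bsub>M\<^esub> u)) = F (p + q) +>\<^bsub>M\<^esub> (a \<odot>\<^bsub>M\<^esub> u)"
    if b: "b \<in> B p" and s: "s \<in> F q" for b s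
  proof -
    note [simp] = B_mem[OF a] B_mem[OF b] F_mem[OF u] F_mem[OF s] lsmult_closed
    let ?r = "b \<odot>\<^bsub>M\<^esub> s \<oplus>\<^bsub>M\<^esub> b \<odot>\<^bsub>M\<^esub> u \<oplus>\<^bsub>M\<^esub> a \<odot>\<^bsub>M\<^esub> s"
    have r: "?r \<in> F (p + q)"
      using B_smult_F[OF b u] B_smult_F[OF b, of s q] s F_step[of q] B_Suc_smult_F[OF a s]
      by (auto intro!: add_F)
    have "(b \<oplus> a) \<odot>\<^bsub>M\<^esub> (s \<oplus>\<^bsub>M\<^esub> u) = ?r \<oplus>\<^bsub>M\<^esub> a \<odot>\<^bsub>M\<^esub> u"
      by (simp add: lsmult_l_distr lsmult_r_distr M.a_ac)
    then have "(b \<oplus> a) \<odot>\<^bsub>M\<^esub> (s \<oplus>\<^bsub>M\<^esub> u) \<ominus>\<^bsub>M\<^esub> a \<odot>\<^bsub>M\<^esub> u = ?r"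
      by (simp add: a_minus_def M.a_assoc M.r_neg)
    then show ?thesis using r by (subst coset_eq_iff) auto
  qed
  then have "rcoset_smult M (F (p + q)) (B p +>\<^bsub>A\<^esub> a) (F q +>\<^bsub>M\<^esub> u)
    = (\<Union>b \<in> B p. \<Union>s \<in> F q. F (p + q) +>\<^bsub>M\<^esub> (a \<odot>\<^bsub>M\<^esub> u))"
    by (simp add: rcoset_smult_def a_r_coset_def'[of A] a_r_coset_def'[of M "F q"])
  then show ?thesis using zero_B zero_F by auto
qed

lemma rcoset_smult_closed:
  assumes "U \<in> carrier (gr_component A AA p)" "V \<in> carrier (G q)"
  shows "rcoset_smult M (F (p + q)) U V \<in> carrier (G (p + q))"
proof -
  obtain a u where "a \<in> B (Suc p)" "U = B p +>\<^bsub>A\<^esub> a" "u \<in> F (Suc q)" "V = F q +>\<^bsub>M\<^esub> u"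
    using assms by (auto simp: gr_component_carrier)
  then show ?thesis by (simp add: rcoset_smult_cosets G_elemI B_Suc_smult_F_Suc)
qed

lemma gr_elem_ring: "a \<in> B (Suc p) \<Longrightarrow> gr_elem A AA p a \<in> carrier (gr_ring A AA)"
  using R.gr_elem_homogeneous[OF B_closed zero_B, of a p] by (simp add: gr_homogeneous_def gr_ring_def)

lemma gr_elem_module: "u \<in> F (Suc k) \<Longrightarrow> gr_elem M MM k u \<in> gr_homogeneous M MM k"
  by (rule M.gr_elem_homogeneous[OF F_closed zero_F])

text \<open>
  Every homogeneous element of \<open>Gr(M)\<close> has a representative in \<open>M\<close>, so a graded map out of \<open>Gr(M)\<close>
  can be followed on representatives.
\<close>

lemma homogeneous_eq_gr_elem:
  assumes "v \<in> gr_homogeneous M MM k"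
  obtains u where "u \<in> F (Suc k)" "v = gr_elem M MM k u"
proof -
  have "v k \<in> carrier (G k)" using assms by (simp add: gr_homogeneous_def gr_carrier_def)
  then obtain u where u: "u \<in> F (Suc k)" "v k = F k +>\<^bsub>M\<^esub> u" by (rule G_elemE)
  have "v = gr_elem M MM k u"
  proof (rule ext)
    fix j
    show "v j = gr_elem M MM k u j"
      using assms u(2) by (cases "j = k") (auto simp: gr_homogeneous_def gr_elem_def gr_component_one coset_zero)
  qed
  then show thesis using u that by blast
qed

lemma gr_elem_eq_iff:
  "u \<in> carrier M \<Longrightarrow> v \<in> carrier M \<Longrightarrow> gr_elem M MM k u = gr_elem M MM k v \<longleftrightarrow> u \<ominus>\<^bsub>M\<^esub> v \<in> F k"
proof
  assume uv: "u \<in> carrier M" "v \<in> carrier M"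
  assume "gr_elem M MM k u = gr_elem M MM k v"
  then have "gr_elem M MM k u k = gr_elem M MM k v k" by simp
  then show "u \<ominus>\<^bsub>M\<^esub> v \<in> F k" using uv by (simp add: gr_elem_def coset_eq_iff)
next
  assume "u \<in> carrier M" "v \<in> carrier M" "u \<ominus>\<^bsub>M\<^esub> v \<in> F k"
  then show "gr_elem M MM k u = gr_elem M MM k v"
    using coset_eq_iff[of u v k] by (intro ext) (simp add: gr_elem_def)
qed

text \<open>
  In the convolution defining the action of \<open>Gr(A)\<close> the first factor is nonzero only at index \<open>p\<close>
  and the second only at index \<open>q\<close>, so a single summand in degree \<open>p + q\<close> survives.
\<close>

lemma gr_elem_smult:
  assumes a: "a \<in> B (Suc p)" and u: "u \<in> F (Suc q)"
  shows "gr_elem A AA p a \<odot>\<^bsub>gr_module M MM\<^esub> gr_elem M MM q u = gr_elem M MM (p + q) (a \<odot>\<^bsub>M\<^esub> u)"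
proof (rule ext)
  fix k
  interpret G: comm_group "G k" by (rule comm_group_G)
  let ?a = "\<lambda>i. if i = p then a else \<zero>" and ?u = "\<lambda>i. if i = q then u else \<zero>\<^bsub>M\<^esub>"
  have summand: "rcoset_smult M (F k) (gr_elem A AA p a i) (gr_elem M MM q u (k - i))
      = (if i = p then F k +>\<^bsub>M\<^esub> (if k = p + q then a \<odot>\<^bsub>M\<^esub> u else \<zero>\<^bsub>M\<^esub>) else \<one>\<^bsub>G k\<^esub>)"
    if "i \<in> {..k}" for i
  proof -
    have "?a i \<in> B (Suc i)" "?u (k - i) \<in> F (Suc (k - i))"
      using a u zero_B zero_F by auto
    from rcoset_smult_cosets[OF this]
    have "rcoset_smult M (F k) (gr_elem A AA p a i) (gr_elem M MM q u (k - i))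
      = F k +>\<^bsub>M\<^esub> (?a i \<odot>\<^bsub>M\<^esub> ?u (k - i))"
      using that by (simp add: gr_elem_def)
    also have "?a i \<odot>\<^bsub>M\<^esub> ?u (k - i) = (if i = p \<and> k = p + q then a \<odot>\<^bsub>M\<^esub> u else \<zero>\<^bsub>M\<^esub>)"
      using that B_mem[OF a] F_mem[OF u] by (auto simp: zero_smult smult_zero)
    finally show ?thesis by (simp add: gr_component_one coset_zero)
  qed
  have closed: "F k +>\<^bsub>M\<^esub> (if k = p + q then a \<odot>\<^bsub>M\<^esub> u else \<zero>\<^bsub>M\<^esub>) \<in> carrier (G k)"
    using B_Suc_smult_F_Suc[OF a u] zero_F by (auto intro!: G_elemI)
  have "(gr_elem A AA p a \<odot>\<^bsub>gr_module M MM\<^esub> gr_elem M MM q u) k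
    = finprod (G k) (\<lambda>i. rcoset_smult M (F k) (gr_elem A AA p a i) (gr_elem M MM q u (k - i))) {..k}"
    by (simp add: gr_module_def)
  also have "\<dots> = finprod (G k) (\<lambda>i. if i = p then F k +>\<^bsub>M\<^esub> (if k = p + q then a \<odot>\<^bsub>M\<^esub> u else \<zero>\<^bsub>M\<^esub>) else \<one>\<^bsub>G k\<^esub>) {..k}"
    by (rule G.finprod_cong') (use summand closed in auto)
  also have "\<dots> = F k +>\<^bsub>M\<^esub> (if k = p + q then a \<odot>\<^bsub>M\<^esub> u else \<zero>\<^bsub>M\<^esub>)"
  proof (cases "p \<le> k")
    case True
    then show ?thesis using G.finprod_singleton_swap[of p "{..k}" "\<lambda>i. F k +>\<^bsub>M\<^esub> (if k = p + q then a \<odot>\<^bsub>M\<^esub> u else \<zero>\<^bsub>M\<^esub>)"] closed by simp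
  next
    case False
    then have "finprod (G k) (\<lambda>i. if i = p then F k +>\<^bsub>M\<^esub> (if k = p + q then a \<odot>\<^bsub>M\<^esub> u else \<zero>\<^bsub>M\<^esub>) else \<one>\<^bsub>G k\<^esub>) {..k} = \<one>\<^bsub>G k\<^esub>"
      by (intro G.finprod_one_eqI) auto
    then show ?thesis using False by (simp add: gr_component_one coset_zero)
  qed
  finally show "(gr_elem A AA p a \<odot>\<^bsub>gr_module M MM\<^esub> gr_elem M MM q u) k
    = gr_elem M MM (p + q) (a \<odot>\<^bsub>M\<^esub> u) k"
    by (simp add: gr_elem_def)
qed

end

section \<open>Isomorphisms of associated graded modules\<close>

text \<open>
  A degreewise isomorphism \<open>Gr(M) \<rightarrow> Gr(N)\<close> is encoded by the relations \<open>T k\<close> between representatives: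
  \<open>(u, w) \<in> T k\<close> means that the class of \<open>u\<close> in degree \<open>k\<close> is sent to the class of \<open>w\<close>.  With a
  relation no representatives have to be chosen, and the map on cosets is the relational image.
\<close>

locale gr_correspondence =
  M: semi_graded A M AA MM + N: semi_graded A N AA NN
  for A :: "('a, 'c) ring_scheme" (structure)
    and M :: "('a, 'm, 'd) module_scheme" and N :: "('a, 'l, 'e) module_scheme"
    and AA :: "nat \<Rightarrow> 'a set" and MM :: "nat \<Rightarrow> 'm set" and NN :: "nat \<Rightarrow> 'l set" +
  fixes T :: "nat \<Rightarrow> ('m \<times> 'l) set"
  assumes T_sub: "T k \<subseteq> M.F (Suc k) \<times> N.F (Suc k)"
    and T_add: "\<lbrakk>(u, w) \<in> T k; (u', w') \<in> T k\<rbrakk> \<Longrightarrow> (u \<oplus>\<^bsub>M\<^esub> u', w \<oplus>\<^bsub>N\<^esub> w') \<in> T k"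
    and T_minus: "\<lbrakk>(u, w) \<in> T k; (u', w') \<in> T k\<rbrakk> \<Longrightarrow> (u \<ominus>\<^bsub>M\<^esub> u', w \<ominus>\<^bsub>N\<^esub> w') \<in> T k"
    and T_lower: "\<lbrakk>u \<in> M.F k; w \<in> N.F k\<rbrakk> \<Longrightarrow> (u, w) \<in> T k"
    and T_iff: "(u, w) \<in> T k \<Longrightarrow> u \<in> M.F k \<longleftrightarrow> w \<in> N.F k"
    and T_left: "u \<in> M.F (Suc k) \<Longrightarrow> \<exists>w. (u, w) \<in> T k"
    and T_right: "w \<in> N.F (Suc k) \<Longrightarrow> \<exists>u. (u, w) \<in> T k"
    and T_smult: "\<lbrakk>a \<in> M.B (Suc p); (u, w) \<in> T q\<rbrakk> \<Longrightarrow> (a \<odot>\<^bsub>M\<^esub> u, a \<odot>\<^bsub>N\<^esub> w) \<in> T (p + q)"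
begin

lemma T_mem: "(u, w) \<in> T k \<Longrightarrow> u \<in> M.F (Suc k)" "(u, w) \<in> T k \<Longrightarrow> w \<in> N.F (Suc k)"
  using T_sub by blast+

lemma T_closed: "(u, w) \<in> T k \<Longrightarrow> u \<in> carrier M" "(u, w) \<in> T k \<Longrightarrow> w \<in> carrier N"
  using T_mem M.F_mem N.F_mem by blast+

text \<open>
  Two partners of elements congruent modulo \<open>M.F k\<close> differ by a partner of an element of \<open>M.F k\<close>, which
  by \<open>T_iff\<close> lies in \<open>N.F k\<close>.  Hence the image of a coset is again one full coset.
\<close>

lemma Image_coset:
  assumes uw: "(u, w) \<in> T k"
  shows "T k `` (M.F k +>\<^bsub>M\<^esub> u) = N.F k +>\<^bsub>N\<^esub> w"
proof (intro equalityI subsetI)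
  fix z assume "z \<in> T k `` (M.F k +>\<^bsub>M\<^esub> u)"
  then obtain s where s: "s \<in> M.F k" "(s \<oplus>\<^bsub>M\<^esub> u, z) \<in> T k" by (auto simp: a_r_coset_def')
  have u: "u \<in> carrier M" and w: "w \<in> carrier N" and z: "z \<in> carrier N"
    using T_closed[OF uw] T_closed[OF s(2)] by auto
  have "s \<oplus>\<^bsub>M\<^esub> u \<ominus>\<^bsub>M\<^esub> u = s"
    using u M.F_mem[OF s(1)] by (simp add: a_minus_def M.M.a_assoc M.M.r_neg)
  then have "z \<ominus>\<^bsub>N\<^esub> w \<in> N.F k"
    using T_minus[OF s(2) uw] s(1) T_iff by metis
  moreover have "z = (z \<ominus>\<^bsub>N\<^esub> w) \<oplus>\<^bsub>N\<^esub> w"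
    using w z by (simp add: a_minus_def N.M.a_assoc N.M.l_neg)
  ultimately show "z \<in> N.F k +>\<^bsub>N\<^esub> w" by (auto simp: a_r_coset_def')
next
  fix z assume "z \<in> N.F k +>\<^bsub>N\<^esub> w"
  then obtain s where s: "s \<in> N.F k" "z = s \<oplus>\<^bsub>N\<^esub> w" by (auto simp: a_r_coset_def')
  have "(\<zero>\<^bsub>M\<^esub> \<oplus>\<^bsub>M\<^esub> u, z) \<in> T k"
    unfolding s(2) by (intro T_add T_lower M.zero_F s(1) uw)
  moreover have "\<zero>\<^bsub>M\<^esub> \<oplus>\<^bsub>M\<^esub> u \<in> M.F k +>\<^bsub>M\<^esub> u"
    using M.zero_F by (auto simp: a_r_coset_def')
  ultimately show "z \<in> T k `` (M.F k +>\<^bsub>M\<^esub> u)" by blast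
qed

lemma G_elem_T:
  assumes "U \<in> carrier (M.G k)"
  obtains u w where "(u, w) \<in> T k" "U = M.F k +>\<^bsub>M\<^esub> u" "T k `` U = N.F k +>\<^bsub>N\<^esub> w"
proof -
  obtain u where u: "u \<in> M.F (Suc k)" "U = M.F k +>\<^bsub>M\<^esub> u" using assms by (rule M.G_elemE)
  obtain w where w: "(u, w) \<in> T k" using T_left[OF u(1)] by blast
  show thesis using that[OF w u(2)] Image_coset[OF w] u(2) by simp
qed

lemma Image_hom: "Image (T k) \<in> hom (M.G k) (N.G k)"
proof (rule homI)
  fix U assume U: "U \<in> carrier (M.G k)"
  obtain u w where uw: "(u, w) \<in> T k" "U = M.F k +>\<^bsub>M\<^esub> u" "T k `` U = N.F k +>\<^bsub>N\<^esub> w"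
    using U by (rule G_elem_T)
  show "T k `` U \<in> carrier (N.G k)" unfolding uw(3) by (rule N.G_elemI[OF T_mem(2)[OF uw(1)]])
  fix V assume V: "V \<in> carrier (M.G k)"
  obtain u' w' where uw': "(u', w') \<in> T k" "V = M.F k +>\<^bsub>M\<^esub> u'" "T k `` V = N.F k +>\<^bsub>N\<^esub> w'"
    using V by (rule G_elem_T)
  have "U \<otimes>\<^bsub>M.G k\<^esub> V = M.F k +>\<^bsub>M\<^esub> (u \<oplus>\<^bsub>M\<^esub> u')"
    unfolding uw(2) uw'(2) by (rule M.G_mult[OF T_closed(1)[OF uw(1)] T_closed(1)[OF uw'(1)]])
  then have "T k `` (U \<otimes>\<^bsub>M.G k\<^esub> V) = N.F k +>\<^bsub>N\<^esub> (w \<oplus>\<^bsub>N\<^esub> w')"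
    by (simp add: Image_coset[OF T_add[OF uw(1) uw'(1)]])
  also have "\<dots> = T k `` U \<otimes>\<^bsub>N.G k\<^esub> T k `` V"
    unfolding uw(3) uw'(3) by (rule N.G_mult[OF T_closed(2)[OF uw(1)] T_closed(2)[OF uw'(1)], symmetric])
  finally show "T k `` (U \<otimes>\<^bsub>M.G k\<^esub> V) = T k `` U \<otimes>\<^bsub>N.G k\<^esub> T k `` V" .
qed

lemma Image_inj: "inj_on (Image (T k)) (carrier (M.G k))"
proof (rule inj_onI)
  fix U V assume UV: "U \<in> carrier (M.G k)" "V \<in> carrier (M.G k)" "T k `` U = T k `` V"
  obtain u w where uw: "(u, w) \<in> T k" "U = M.F k +>\<^bsub>M\<^esub> u" "T k `` U = N.F k +>\<^bsub>N\<^esub> w"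
    using UV(1) by (rule G_elem_T)
  obtain u' w' where uw': "(u', w') \<in> T k" "V = M.F k +>\<^bsub>M\<^esub> u'" "T k `` V = N.F k +>\<^bsub>N\<^esub> w'"
    using UV(2) by (rule G_elem_T)
  have "w \<ominus>\<^bsub>N\<^esub> w' \<in> N.F k"
    using UV(3) N.coset_eq_iff[OF T_closed(2)[OF uw(1)] T_closed(2)[OF uw'(1)]] by (simp add: uw(3) uw'(3))
  then have "u \<ominus>\<^bsub>M\<^esub> u' \<in> M.F k" using T_iff[OF T_minus[OF uw(1) uw'(1)]] by simp
  then show "U = V"
    using M.coset_eq_iff[OF T_closed(1)[OF uw(1)] T_closed(1)[OF uw'(1)]] by (simp add: uw(2) uw'(2))
qed

lemma Image_surj: "Image (T k) ` carrier (M.G k) = carrier (N.G k)"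
proof (intro equalityI subsetI)
  fix W assume "W \<in> carrier (N.G k)"
  then obtain w where w: "w \<in> N.F (Suc k)" "W = N.F k +>\<^bsub>N\<^esub> w" by (rule N.G_elemE)
  obtain u where u: "(u, w) \<in> T k" using T_right[OF w(1)] by blast
  have "W = T k `` (M.F k +>\<^bsub>M\<^esub> u)" using Image_coset[OF u] w(2) by simp
  then show "W \<in> Image (T k) ` carrier (M.G k)" using M.G_elemI[OF T_mem(1)[OF u]] by blast
next
  fix W assume "W \<in> Image (T k) ` carrier (M.G k)"
  then obtain U where "U \<in> carrier (M.G k)" "W = T k `` U" by blast
  then show "W \<in> carrier (N.G k)" using hom_in_carrier[OF Image_hom] by simp
qed

lemma Image_one: "T k `` \<one>\<^bsub>M.G k\<^esub> = \<one>\<^bsub>N.G k\<^esub>"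
  using Image_coset[OF T_lower[OF M.zero_F N.zero_F]]
  by (simp add: gr_component_one M.coset_zero N.coset_zero)

lemma Image_eq_one: "U \<in> carrier (M.G k) \<Longrightarrow> T k `` U = \<one>\<^bsub>N.G k\<^esub> \<longleftrightarrow> U = \<one>\<^bsub>M.G k\<^esub>"
  using inj_onD[OF Image_inj[of k], of U "\<one>\<^bsub>M.G k\<^esub>"] Image_one[of k]
    comm_monoid.axioms(1)[OF comm_group.axioms(1)[OF M.comm_group_G[of k]]] monoid.one_closed
  by metis

lemma Image_rcoset_smult:
  assumes "U \<in> carrier (gr_component A AA p)" "V \<in> carrier (M.G q)"
  shows "T (p + q) `` (rcoset_smult M (M.F (p + q)) U V) = rcoset_smult N (N.F (p + q)) U (T q `` V)"
proof -
  obtain a where a: "a \<in> M.B (Suc p)" "U = M.B p +>\<^bsub>A\<^esub> a" using assms(1) by (auto simp: gr_component_carrier)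
  obtain u w where uw: "(u, w) \<in> T q" "V = M.F q +>\<^bsub>M\<^esub> u" "T q `` V = N.F q +>\<^bsub>N\<^esub> w"
    using assms(2) by (rule G_elem_T)
  show ?thesis
    unfolding uw(3) unfolding uw(2) a(2) M.rcoset_smult_cosets[OF a(1) T_mem(1)[OF uw(1)]]
      N.rcoset_smult_cosets[OF a(1) T_mem(2)[OF uw(1)]]
    by (rule Image_coset[OF T_smult[OF a(1) uw(1)]])
qed

definition gr_map :: "(nat \<Rightarrow> 'm set) \<Rightarrow> nat \<Rightarrow> 'l set" where
  "gr_map u = (\<lambda>k. T k `` u k)"

lemma gr_carrier_component: "u \<in> gr_carrier M MM \<Longrightarrow> u k \<in> carrier (M.G k)"
  by (simp add: gr_carrier_def)

lemma gr_map_closed: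
  assumes "u \<in> gr_carrier M MM" shows "gr_map u \<in> gr_carrier N NN"
proof -
  have "gr_map u k \<in> carrier (N.G k)" for k
    using Image_surj gr_carrier_component[OF assms] unfolding gr_map_def by blast
  moreover have "{k. gr_map u k \<noteq> \<one>\<^bsub>N.G k\<^esub>} = {k. u k \<noteq> \<one>\<^bsub>M.G k\<^esub>}"
    using Image_eq_one[OF gr_carrier_component[OF assms]] unfolding gr_map_def by simp
  ultimately show ?thesis using assms by (simp add: gr_carrier_def)
qed

lemma gr_map_bij: "bij_betw gr_map (gr_carrier M MM) (gr_carrier N NN)"
proof (rule bij_betwI')
  fix u v assume uv: "u \<in> gr_carrier M MM" "v \<in> gr_carrier M MM"
  have "u k = v k" if "gr_map u = gr_map v" for k
  proof -
    have "T k `` u k = T k `` v k" using that by (metis gr_map_def)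
    then show ?thesis
      using inj_onD[OF Image_inj] gr_carrier_component[OF uv(1)] gr_carrier_component[OF uv(2)] by blast
  qed
  then show "gr_map u = gr_map v \<longleftrightarrow> u = v" by auto
next
  fix w assume w: "w \<in> gr_carrier N NN"
  have "\<exists>U. U \<in> carrier (M.G k) \<and> w k = T k `` U" for k
    using w Image_surj[of k] unfolding gr_carrier_def by blast
  then obtain u where u: "\<And>k. u k \<in> carrier (M.G k)" "\<And>k. w k = T k `` u k" by metis
  have "{k. w k \<noteq> \<one>\<^bsub>N.G k\<^esub>} = {k. u k \<noteq> \<one>\<^bsub>M.G k\<^esub>}"
    using Image_eq_one[OF u(1)] u(2) by simp
  then have "u \<in> gr_carrier M MM" using w u(1) by (simp add: gr_carrier_def)
  moreover have "w = gr_map u" using u(2) by (auto simp: gr_map_def)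
  ultimately show "\<exists>u \<in> gr_carrier M MM. w = gr_map u" by blast
qed (rule gr_map_closed)

text \<open>
  In each degree \<open>k\<close> the action of \<open>Gr(A)\<close> is a product over \<open>i \<le> k\<close> of coset products.  The
  degree-\<open>k\<close> part of the map is a group homomorphism compatible with each factor of this product.
\<close>

lemma gr_map_smult:
  assumes a: "a \<in> gr_carrier A AA" and u: "u \<in> gr_carrier M MM"
  shows "gr_map (a \<odot>\<^bsub>gr_module M MM\<^esub> u) = a \<odot>\<^bsub>gr_module N NN\<^esub> gr_map u"
proof (rule ext)
  fix k
  interpret GM: comm_group "M.G k" by (rule M.comm_group_G)
  interpret GN: comm_group "N.G k" by (rule N.comm_group_G)
  interpret h: group_hom "M.G k" "N.G k" "Image (T k)"
    by (rule group_hom.intro[OF GM.is_group GN.is_group]) (simp add: group_hom_axioms_def Image_hom)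
  let ?t = "\<lambda>i. rcoset_smult M (M.F k) (a i) (u (k - i))"
  have a_mem: "a i \<in> carrier (gr_component A AA i)" for i using a by (simp add: gr_carrier_def)
  have t: "?t i \<in> carrier (M.G k)" if "i \<le> k" for i
    using M.rcoset_smult_closed[OF a_mem[of i] gr_carrier_component[OF u, of "k - i"]] that by simp
  have im: "T k `` ?t i = rcoset_smult N (N.F k) (a i) (gr_map u (k - i))" if "i \<le> k" for i
    using Image_rcoset_smult[OF a_mem[of i] gr_carrier_component[OF u, of "k - i"]] that by (simp add: gr_map_def)
  have "T k `` finprod (M.G k) ?t {..l} = finprod (N.G k) (\<lambda>i. rcoset_smult N (N.F k) (a i) (gr_map u (k - i))) {..l}"
    if "l \<le> k" for l
    using that
  proof (induct l)
    case 0
    then show ?case using t[of 0] im[of 0] h.hom_closed[OF t[of 0]] by simp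
  next
    case (Suc l)
    have tl: "?t \<in> {..Suc l} \<rightarrow> carrier (M.G k)" using t Suc(2) by auto
    have "rcoset_smult N (N.F k) (a i) (gr_map u (k - i)) \<in> carrier (N.G k)" if "i \<le> k" for i
      using h.hom_closed[OF t[OF that]] im[OF that] by simp
    then have tl': "(\<lambda>i. rcoset_smult N (N.F k) (a i) (gr_map u (k - i))) \<in> {..Suc l} \<rightarrow> carrier (N.G k)"
      using Suc(2) by auto
    have "finprod (M.G k) ?t {..l} \<in> carrier (M.G k)" using tl by (intro GM.finprod_closed) auto
    then show ?case
      unfolding GM.finprod_Suc[OF tl] GN.finprod_Suc[OF tl'] using Suc im[of "Suc l"] t[of "Suc l"] by simp
  qed
  then show "gr_map (a \<odot>\<^bsub>gr_module M MM\<^esub> u) k = (a \<odot>\<^bsub>gr_module N NN\<^esub> gr_map u) k"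
    by (simp add: gr_module_def gr_map_def)
qed

lemma gr_map_homogeneous:
  assumes "u \<in> gr_homogeneous M MM k"
  shows "gr_map u \<in> gr_homogeneous N NN k"
  using assms gr_map_closed Image_one by (simp add: gr_homogeneous_def gr_map_def)

lemma gr_modules_isomorphic:
  "graded_isomorphic (gr_ring A AA) (gr_module M MM) (gr_homogeneous M MM)
     (gr_module N NN) (gr_homogeneous N NN)"
proof -
  have "gr_map (u \<oplus>\<^bsub>gr_module M MM\<^esub> v) = gr_map u \<oplus>\<^bsub>gr_module N NN\<^esub> gr_map v"
    if "u \<in> gr_carrier M MM" "v \<in> gr_carrier M MM" for u v
    using hom_mult[OF Image_hom gr_carrier_component[OF that(1)] gr_carrier_component[OF that(2)]]
    by (simp add: gr_map_def gr_module_def fun_eq_iff)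
  then have "gr_map \<in> hom (add_monoid (gr_module M MM)) (add_monoid (gr_module N NN))"
    using gr_map_closed by (intro homI) (simp_all add: gr_module_def)
  then have "gr_map \<in> left_module_iso (gr_ring A AA) (gr_module M MM) (gr_module N NN)"
    using gr_map_bij gr_map_smult unfolding left_module_iso_def iso_def
    by (simp add: gr_ring_def gr_module_def)
  then show ?thesis unfolding graded_isomorphic_def using gr_map_homogeneous by blast
qed

end

section \<open>Skew PBW extensions of a central field\<close>

text \<open>
  A sum over an infinite index set is zero by convention, so finiteness is what makes the sums in
  \<^const>\<open>pbw_piece\<close> the intended spans.
\<close>

lemma finite_exponents: "finite {\<alpha> \<in> exponents n. (\<Sum>i = 1..n. \<alpha> i) = k}"
proof (rule finite_subset)
  show "{\<alpha> \<in> exponents n. (\<Sum>i = 1..n. \<alpha> i) = k}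
      \<subseteq> {\<alpha>. \<forall>i. (i \<in> {1..n} \<longrightarrow> \<alpha> i \<in> {..k}) \<and> (i \<notin> {1..n} \<longrightarrow> \<alpha> i = 0)}"
    using member_le_sum[of _ "{1..n}"] by (auto simp: exponents_def)
  show "finite {\<alpha>. \<forall>i. (i \<in> {1..n} \<longrightarrow> \<alpha> i \<in> {..k}) \<and> (i \<notin> {1..n} \<longrightarrow> \<alpha> i = (0::nat))}"
    by (rule finite_set_of_finite_funs) simp_all
qed

locale central_PBW_extension = skew_PBW_extension A K n x
  for A :: "('a, 'c) ring_scheme" (structure) and K n x +
  assumes base_field: "subfield K A"
    and base_central: "central_in K A"
begin

abbreviation piece where "piece \<equiv> pbw_piece A K n x"

lemma K_closed: "r \<in> K \<Longrightarrow> r \<in> carrier A"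
  using subringE(1)[OF base_subring] by blast

lemmas K_zero = subringE(2)[OF base_subring]
  and K_one = subringE(3)[OF base_subring]
  and K_neg = subringE(5)[OF base_subring]
  and K_mult = subringE(6)[OF base_subring]
  and K_add = subringE(7)[OF base_subring]

lemma K_minus: "r \<in> K \<Longrightarrow> s \<in> K \<Longrightarrow> r \<ominus> s \<in> K"
  unfolding a_minus_def by (intro K_add K_neg)

lemma K_inv: "r \<in> K \<Longrightarrow> r \<noteq> \<zero> \<Longrightarrow> inv r \<in> K"
  and K_inv_nonzero: "r \<in> K \<Longrightarrow> r \<noteq> \<zero> \<Longrightarrow> inv r \<noteq> \<zero>"
  and K_l_inv: "r \<in> K \<Longrightarrow> r \<noteq> \<zero> \<Longrightarrow> inv r \<otimes> r = \<one>"
  using subfield_m_inv[OF base_field, of r] by auto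

lemma K_mult_nonzero: "r \<in> K \<Longrightarrow> s \<in> K \<Longrightarrow> r \<noteq> \<zero> \<Longrightarrow> s \<noteq> \<zero> \<Longrightarrow> r \<otimes> s \<noteq> \<zero>"
  using subfieldE(5)[OF base_field, of r s] by blast

lemma K_central: "r \<in> K \<Longrightarrow> a \<in> carrier A \<Longrightarrow> a \<otimes> r = r \<otimes> a"
  using base_central by (simp add: central_in_def)

lemma var_closed: "i \<in> {1..n} \<Longrightarrow> x i \<in> carrier A"
  using vars_closed by auto

lemma monomial_closed_upto: "m \<le> n \<Longrightarrow> pbw_monomial A x m \<alpha> \<in> carrier A"
  by (induct m) (auto simp: var_closed)

lemma monomial_closed: "pbw_monomial A x n \<alpha> \<in> carrier A"
  by (rule monomial_closed_upto) simp

text \<open>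
  With the analogous principles for graded pieces and affine spans below, membership in a set closed
  under addition only has to be checked on scalar multiples of generators.
\<close>

lemma span_induct:
  assumes "S \<subseteq> carrier A" "\<zero> \<in> S" "\<And>a b. a \<in> S \<Longrightarrow> b \<in> S \<Longrightarrow> a \<oplus> b \<in> S"
    and mon: "\<And>r \<alpha>. r \<in> K \<Longrightarrow> \<alpha> \<in> exponents n \<Longrightarrow> r \<otimes> pbw_monomial A x n \<alpha> \<in> S"
  shows "carrier A \<subseteq> S"
proof
  fix a assume "a \<in> carrier A"
  then obtain f where f: "range f \<subseteq> K" "\<And>\<alpha>. \<alpha> \<notin> exponents n \<Longrightarrow> f \<alpha> = \<zero>"
    "a = finsum (regular_module A) (\<lambda>\<alpha>. f \<alpha> \<odot>\<^bsub>regular_module A\<^esub> pbw_monomial A x n \<alpha>) {\<alpha>. f \<alpha> \<noteq> \<zero>}"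
    using free_on_monomials unfolding is_free_basis_def by blast
  have "a = (\<Oplus>\<alpha> \<in> {\<alpha>. f \<alpha> \<noteq> \<zero>}. f \<alpha> \<otimes> pbw_monomial A x n \<alpha>)"
    unfolding f(3) by (simp add: finsum_def finprod_def regular_module_def)
  then show "a \<in> S" using f(1,2) by (auto intro!: finsum_mem assms)
qed

lemma piece_induct:
  assumes "S \<subseteq> carrier A" "\<zero> \<in> S" "\<And>a b. a \<in> S \<Longrightarrow> b \<in> S \<Longrightarrow> a \<oplus> b \<in> S"
    and mon: "\<And>r \<alpha>. r \<in> K \<Longrightarrow> \<alpha> \<in> exponents n \<Longrightarrow> (\<Sum>i = 1..n. \<alpha> i) = p \<Longrightarrow> r \<otimes> pbw_monomial A x n \<alpha> \<in> S"
  shows "piece p \<subseteq> S"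
proof
  fix a assume "a \<in> piece p"
  then obtain f where f: "f \<in> {\<alpha> \<in> exponents n. (\<Sum>i = 1..n. \<alpha> i) = p} \<rightarrow> K"
    "a = (\<Oplus>\<alpha> \<in> {\<alpha> \<in> exponents n. (\<Sum>i = 1..n. \<alpha> i) = p}. f \<alpha> \<otimes> pbw_monomial A x n \<alpha>)"
    unfolding pbw_piece_def Let_def by blast
  show "a \<in> S" unfolding f(2)
  proof (rule finsum_mem)
    fix \<alpha> assume "\<alpha> \<in> {\<alpha> \<in> exponents n. (\<Sum>i = 1..n. \<alpha> i) = p}"
    then show "f \<alpha> \<otimes> pbw_monomial A x n \<alpha> \<in> S" using f(1) by (intro mon) auto
  qed (use assms in auto)
qed

lemma PBW_piece_closed: "piece p \<subseteq> carrier A"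
  by (rule piece_induct) (auto simp: K_closed monomial_closed)

lemma pieceI:
  assumes "f \<in> {\<alpha> \<in> exponents n. (\<Sum>i = 1..n. \<alpha> i) = p} \<rightarrow> K"
  shows "(\<Oplus>\<alpha> \<in> {\<alpha> \<in> exponents n. (\<Sum>i = 1..n. \<alpha> i) = p}. f \<alpha> \<otimes> pbw_monomial A x n \<alpha>) \<in> piece p"
  unfolding pbw_piece_def Let_def using assms by blast

lemma monomial_in_piece:
  assumes "r \<in> K" "\<alpha> \<in> exponents n"
  shows "r \<otimes> pbw_monomial A x n \<alpha> \<in> piece (\<Sum>i = 1..n. \<alpha> i)"
proof -
  let ?E = "{\<beta> \<in> exponents n. (\<Sum>i = 1..n. \<beta> i) = (\<Sum>i = 1..n. \<alpha> i)}"
  let ?f = "\<lambda>\<beta>. if \<beta> = \<alpha> then r else \<zero>"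
  have "(\<Oplus>\<beta> \<in> ?E. ?f \<beta> \<otimes> pbw_monomial A x n \<beta>)
    = (\<Oplus>\<beta> \<in> ?E. if \<beta> = \<alpha> then r \<otimes> pbw_monomial A x n \<beta> else \<zero>)"
    by (rule finsum_cong') (use assms(1) in \<open>auto simp: K_closed monomial_closed\<close>)
  also have "\<dots> = r \<otimes> pbw_monomial A x n \<alpha>"
    by (rule add.finprod_singleton_swap)
      (use assms finite_exponents in \<open>auto simp: K_closed monomial_closed\<close>)
  finally have eq: "(\<Oplus>\<beta> \<in> ?E. ?f \<beta> \<otimes> pbw_monomial A x n \<beta>) = r \<otimes> pbw_monomial A x n \<alpha>" .
  have f: "?f \<in> ?E \<rightarrow> K" using assms(1) K_zero by auto
  show ?thesis using pieceI[OF f] unfolding eq .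
qed

lemma zero_in_PBW_piece: "\<zero> \<in> piece p"
proof -
  let ?E = "{\<beta> \<in> exponents n. (\<Sum>i = 1..n. \<beta> i) = p}"
  have "(\<Oplus>\<beta> \<in> ?E. \<zero> \<otimes> pbw_monomial A x n \<beta>) = (\<Oplus>\<beta> \<in> ?E. \<zero>)"
    by (rule finsum_cong') (auto simp: monomial_closed)
  then have eq: "(\<Oplus>\<beta> \<in> ?E. \<zero> \<otimes> pbw_monomial A x n \<beta>) = \<zero>" by simp
  have f: "(\<lambda>_. \<zero>) \<in> ?E \<rightarrow> K" using K_zero by auto
  show ?thesis using pieceI[OF f] unfolding eq .
qed

lemma K_in_piece:
  assumes "r \<in> K"
  shows "r \<in> piece 0"
proof -
  have "pbw_monomial A x m (\<lambda>_. 0) = \<one>" for m by (induct m) auto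
  then show ?thesis
    using monomial_in_piece[OF assms, of "\<lambda>_. 0"] K_closed[OF assms] by (simp add: exponents_def)
qed

lemma var_in_piece:
  assumes i: "i \<in> {1..n}"
  shows "x i \<in> piece (Suc 0)"
proof -
  let ?\<epsilon> = "\<lambda>j. if j = i then Suc 0 else 0"
  have "pbw_monomial A x m ?\<epsilon> = (if i \<le> m then x i else \<one>)" if "m \<le> n" for m
    using that var_closed[OF i] i by (induct m) (auto simp: le_Suc_eq)
  moreover have "(\<Sum>j = 1..n. ?\<epsilon> j) = Suc 0" using i by simp
  moreover have "?\<epsilon> \<in> exponents n" using i by (auto simp: exponents_def)
  ultimately show ?thesis
    using monomial_in_piece[OF K_one, of ?\<epsilon>] var_closed[OF i] i by simp
qed

lemma affine_span_induct:
  assumes "S \<subseteq> carrier A" "\<zero> \<in> S" "\<And>a b. a \<in> S \<Longrightarrow> b \<in> S \<Longrightarrow> a \<oplus> b \<in> S"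
    and "K \<subseteq> S" "\<And>r i. r \<in> K \<Longrightarrow> i \<in> {1..n} \<Longrightarrow> r \<otimes> x i \<in> S"
  shows "affine_span A K n x \<subseteq> S"
proof
  fix a assume "a \<in> affine_span A K n x"
  then obtain r where r: "r \<in> {0..n} \<rightarrow> K" "a = r 0 \<oplus> (\<Oplus>i \<in> {1..n}. r i \<otimes> x i)"
    unfolding affine_span_def by blast
  have "(\<Oplus>i \<in> {1..n}. r i \<otimes> x i) \<in> S"
  proof (rule finsum_mem)
    fix i assume "i \<in> {1..n}"
    moreover from this have "r i \<in> K" using r(1) by auto
    ultimately show "r i \<otimes> x i \<in> S" by (intro assms(5))
  qed (use assms(1-3) in auto)
  moreover have "r 0 \<in> S" using r(1) assms(4) by auto
  ultimately show "a \<in> S" unfolding r(2) by (rule assms(3)[rotated])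
qed

end

section \<open>Point modules\<close>

text \<open>
  In the associated graded module, \<open>u\<close> and \<open>w\<close> represent nonzero vectors \<open>e\<close> and \<open>e'\<close> in degrees \<open>k\<close>
  and \<open>k + 1\<close>, and the variables act by \<open>x\<^sub>i e = v\<^sub>i e'\<close>.
\<close>

definition leading_coords ::
  "('a, 'c) ring_scheme \<Rightarrow> nat \<Rightarrow> (nat \<Rightarrow> 'a) \<Rightarrow> ('a, 'm, 'd) module_scheme \<Rightarrow> (nat \<Rightarrow> 'm set) \<Rightarrow>
     nat \<Rightarrow> (nat \<Rightarrow> 'a) \<Rightarrow> 'm \<Rightarrow> 'm \<Rightarrow> bool"
where
  "leading_coords A n x M MM k v u w \<longleftrightarrow>
     u \<in> filt_below M MM (Suc k) - filt_below M MM k \<and>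
     w \<in> filt_below M MM (Suc (Suc k)) - filt_below M MM (Suc k) \<and>
     (\<forall>i \<in> {1..n}. (x i \<odot>\<^bsub>M\<^esub> u) \<ominus>\<^bsub>M\<^esub> (v i \<odot>\<^bsub>M\<^esub> w) \<in> filt_below M MM (Suc k))"

text \<open>
  The homogeneous coordinate vectors of the point of projective space through which the variables
  map degree \<open>0\<close> to degree \<open>1\<close>.  The vectors \<open>u\<close> and \<open>w\<close> are left free, so the set is a whole class of
  proportional vectors, which is how projective points are represented.
\<close>

definition point_coords ::
  "('a, 'c) ring_scheme \<Rightarrow> 'a set \<Rightarrow> nat \<Rightarrow> (nat \<Rightarrow> 'a) \<Rightarrow> ('a, 'm, 'd) module_scheme \<Rightarrow> (nat \<Rightarrow> 'm set) \<Rightarrow>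
     (nat \<Rightarrow> 'a) set"
where
  "point_coords A K n x M MM =
     {v \<in> nonzero_vectors A K n. \<exists>u w. leading_coords A n x M MM 0 v u w}"

locale PBW_point_module =
  central_PBW_extension A K n x + semi_graded A M "pbw_piece A K n x" MM
  for A :: "('a, 'c) ring_scheme" (structure) and K n x
    and M :: "('a, 'm, 'd) module_scheme" (structure) and MM :: "nat \<Rightarrow> 'm set" +
  assumes cyclic: "\<exists>m \<in> MM 0. carrier M = {a \<odot>\<^bsub>M\<^esub> m | a. a \<in> carrier A}"
    and dimension: "has_dimension A K M (MM k) 1"
begin

lemma K_smult_F: "r \<in> K \<Longrightarrow> u \<in> F k \<Longrightarrow> r \<odot>\<^bsub>M\<^esub> u \<in> F k"
  using piece_smult_F[OF K_in_piece, of r u k] by simp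

lemma var_smult_F: "i \<in> {1..n} \<Longrightarrow> u \<in> F k \<Longrightarrow> x i \<odot>\<^bsub>M\<^esub> u \<in> F (Suc k)"
  using piece_smult_F[OF var_in_piece, of i u k] by simp

lemma K_smult_commute:
  "r \<in> K \<Longrightarrow> a \<in> carrier A \<Longrightarrow> u \<in> carrier M \<Longrightarrow> a \<odot>\<^bsub>M\<^esub> (r \<odot>\<^bsub>M\<^esub> u) = r \<odot>\<^bsub>M\<^esub> (a \<odot>\<^bsub>M\<^esub> u)"
  by (metis K_central K_closed lsmult_assoc)

lemma inv_smult_cancel:
  "r \<in> K \<Longrightarrow> r \<noteq> \<zero> \<Longrightarrow> u \<in> carrier M \<Longrightarrow> inv r \<odot>\<^bsub>M\<^esub> (r \<odot>\<^bsub>M\<^esub> u) = u"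
  by (metis K_closed K_inv K_l_inv lsmult_assoc lsmult_one)

lemma smult_mem_F_iff:
  assumes "r \<in> K" "r \<noteq> \<zero>" "u \<in> carrier M"
  shows "r \<odot>\<^bsub>M\<^esub> u \<in> F k \<longleftrightarrow> u \<in> F k"
  using K_smult_F[OF assms(1)] K_smult_F[OF K_inv[OF assms(1,2)]] inv_smult_cancel[OF assms] by metis

text \<open>
  For a one-element basis the coefficient functions are determined by their value at the basis vector
  \<open>b\<close>.  If \<open>b\<close> were zero, the coefficients \<open>0\<close> and \<open>1\<close> would represent the same vector.
\<close>

lemma component_basis:
  obtains b where "b \<in> MM k" "b \<noteq> \<zero>\<^bsub>M\<^esub>" "\<And>u. u \<in> MM k \<Longrightarrow> \<exists>r \<in> K. u = r \<odot>\<^bsub>M\<^esub> b"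
proof -
  obtain C where "card C = 1" and free: "is_free_basis A K M (MM k) C (\<lambda>v. v)"
    using dimension[of k] unfolding has_dimension_def by blast
  then obtain b where C: "C = {b}" by (auto simp: card_1_singleton_iff)
  have b: "b \<in> MM k" using free unfolding is_free_basis_def C by auto
  note b_closed = component_mem[OF b]
  have ex1: "\<exists>!f. range f \<subseteq> K \<and> (\<forall>i. i \<notin> {b} \<longrightarrow> f i = \<zero>) \<and> finite {i. f i \<noteq> \<zero>} \<and>
      u = (\<Oplus>\<^bsub>M\<^esub> i \<in> {i. f i \<noteq> \<zero>}. f i \<odot>\<^bsub>M\<^esub> i)" if "u \<in> MM k" for u
    using free that unfolding is_free_basis_def C by blast
  have sum: "(\<Oplus>\<^bsub>M\<^esub> i \<in> {i. f i \<noteq> \<zero>}. f i \<odot>\<^bsub>M\<^esub> i) = f b \<odot>\<^bsub>M\<^esub> b"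
    if "range f \<subseteq> K" "\<forall>i. i \<notin> {b} \<longrightarrow> f i = \<zero>" for f
  proof (cases "f b = \<zero>")
    case True
    then have "{i. f i \<noteq> \<zero>} = {}" using that(2) by auto
    then show ?thesis using True b_closed by (simp add: zero_smult)
  next
    case False
    then have "{i. f i \<noteq> \<zero>} = {b}" using that(2) by auto
    moreover have "f b \<in> carrier A" using that(1) K_closed by blast
    ultimately show ?thesis using b_closed by (simp add: lsmult_closed)
  qed
  show thesis
  proof (rule that[OF b])
    show "b \<noteq> \<zero>\<^bsub>M\<^esub>"
    proof
      assume b0: "b = \<zero>\<^bsub>M\<^esub>"
      let ?f = "\<lambda>i::'m. if i = b then \<one> else \<zero>" and ?g = "\<lambda>i::'m. \<zero>"
      have f: "range ?f \<subseteq> K" "\<forall>i. i \<notin> {b} \<longrightarrow> ?f i = \<zero>" using K_one K_zero by auto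
      have g: "range ?g \<subseteq> K" "\<forall>i. i \<notin> {b} \<longrightarrow> ?g i = \<zero>" using K_zero by auto
      have f': "finite {i. ?f i \<noteq> \<zero>}" by (rule finite_subset[of _ "{b}"]) auto
      have f'': "b = (\<Oplus>\<^bsub>M\<^esub> i \<in> {i. ?f i \<noteq> \<zero>}. ?f i \<odot>\<^bsub>M\<^esub> i)"
        unfolding sum[OF f] using b_closed by (simp add: lsmult_one)
      have g': "finite {i. ?g i \<noteq> \<zero>}" by simp
      have g'': "b = (\<Oplus>\<^bsub>M\<^esub> i \<in> {i. ?g i \<noteq> \<zero>}. ?g i \<odot>\<^bsub>M\<^esub> i)"
        unfolding sum[OF g] using b_closed by (simp add: b0 zero_smult)
      obtain h where h: "\<forall>f. range f \<subseteq> K \<and> (\<forall>i. i \<notin> {b} \<longrightarrow> f i = \<zero>) \<and> finite {i. f i \<noteq> \<zero>} \<and>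
          b = (\<Oplus>\<^bsub>M\<^esub> i \<in> {i. f i \<noteq> \<zero>}. f i \<odot>\<^bsub>M\<^esub> i) \<longrightarrow> f = h"
        using ex1[OF b] by (rule ex1E)
      have "?f = h" by (rule h[rule_format]) (intro conjI f f' f'')
      moreover have "?g = h" by (rule h[rule_format]) (intro conjI g g' g'')
      ultimately have "?f = ?g" by (rule trans[OF _ sym])
      then have "?f b = ?g b" by (rule fun_cong)
      then show False using subfieldE(6)[OF base_field] by simp
    qed
    fix u assume "u \<in> MM k"
    then obtain f where f: "range f \<subseteq> K" "\<forall>i. i \<notin> {b} \<longrightarrow> f i = \<zero>"
      "u = (\<Oplus>\<^bsub>M\<^esub> i \<in> {i. f i \<noteq> \<zero>}. f i \<odot>\<^bsub>M\<^esub> i)"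
      using ex1 by blast
    then show "\<exists>r \<in> K. u = r \<odot>\<^bsub>M\<^esub> b" using sum[OF f(1,2)] by auto
  qed
qed

lemma F_strict: "\<exists>e. e \<in> F (Suc k) - F k"
  using component_basis[of k] component_F component_Int_F by (metis DiffI subset_iff)

text \<open>
  Any vector of exact degree \<open>k\<close>, homogeneous or not, spans the component of degree \<open>k\<close> of \<open>Gr(M)\<close>.
  This allows \<open>x\<^sub>i e\<close> to serve as a basis vector later on.
\<close>

lemma F_quotient_line:
  assumes e: "e \<in> F (Suc k) - F k" and u: "u \<in> F (Suc k)"
  shows "\<exists>r \<in> K. u \<ominus>\<^bsub>M\<^esub> r \<odot>\<^bsub>M\<^esub> e \<in> F k"
proof -
  obtain b where b: "b \<in> MM k" "\<And>u. u \<in> MM k \<Longrightarrow> \<exists>r \<in> K. u = r \<odot>\<^bsub>M\<^esub> b"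
    using component_basis[of k] by blast
  have line: "\<exists>r \<in> K. \<exists>f \<in> F k. u = r \<odot>\<^bsub>M\<^esub> b \<oplus>\<^bsub>M\<^esub> f" if "u \<in> F (Suc k)" for u
    using that b(2) unfolding F_Suc by blast
  obtain s f where s: "s \<in> K" "f \<in> F k" "e = s \<odot>\<^bsub>M\<^esub> b \<oplus>\<^bsub>M\<^esub> f" using line e by blast
  obtain t g where t: "t \<in> K" "g \<in> F k" "u = t \<odot>\<^bsub>M\<^esub> b \<oplus>\<^bsub>M\<^esub> g" using line u by blast
  note [simp] = K_closed[OF s(1)] K_closed[OF t(1)] F_mem[OF s(2)] F_mem[OF t(2)] component_mem[OF b(1)] lsmult_closed
  have s0: "s \<noteq> \<zero>"
  proof
    assume "s = \<zero>"
    then have "e = f" using s(3) by (simp add: zero_smult)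
    then show False using e s(2) by simp
  qed
  let ?r = "t \<otimes> inv s"
  have r: "?r \<in> K" using s(1) t(1) s0 by (intro K_mult K_inv)
  note [simp] = K_closed[OF r] K_closed[OF K_inv[OF s(1) s0]]
  have "?r \<odot>\<^bsub>M\<^esub> (s \<odot>\<^bsub>M\<^esub> b) = t \<odot>\<^bsub>M\<^esub> b"
    using inv_smult_cancel[OF s(1) s0, of b] by (simp add: lsmult_assoc)
  then have "u \<ominus>\<^bsub>M\<^esub> ?r \<odot>\<^bsub>M\<^esub> e = g \<ominus>\<^bsub>M\<^esub> ?r \<odot>\<^bsub>M\<^esub> f"
    unfolding s(3) t(3) by (simp add: lsmult_r_distr a_minus_def M.minus_add M.a_ac M.r_neg1 M.r_neg2)
  also have "\<dots> \<in> F k" by (intro minus_F t(2) K_smult_F r s(2))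
  finally show ?thesis using r by blast
qed

text \<open>
  Scalars and variables generate \<open>A\<close> as a ring, because \<open>A\<close> is spanned by monomials.
\<close>

lemma stable_smult:
  assumes S: "additive_subgroup S M"
    and K: "\<And>r u. r \<in> K \<Longrightarrow> u \<in> S \<Longrightarrow> r \<odot>\<^bsub>M\<^esub> u \<in> S"
    and var: "\<And>i u. i \<in> {1..n} \<Longrightarrow> u \<in> S \<Longrightarrow> x i \<odot>\<^bsub>M\<^esub> u \<in> S"
    and a: "a \<in> carrier A" and u: "u \<in> S"
  shows "a \<odot>\<^bsub>M\<^esub> u \<in> S"
proof -
  have S_closed: "u \<in> carrier M" if "u \<in> S" for u using additive_subgroup.a_subset[OF S] that by blast
  let ?W = "{a \<in> carrier A. \<forall>u \<in> S. a \<odot>\<^bsub>M\<^esub> u \<in> S}"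
  have mult: "a \<otimes> b \<in> ?W" if "a \<in> ?W" "b \<in> ?W" for a b
    using that S_closed by (auto simp: lsmult_assoc)
  have one: "\<one> \<in> ?W" using S_closed by (auto simp: lsmult_one)
  have pow: "x i [^] (l::nat) \<in> ?W" if "i \<in> {1..n}" for i l
  proof (induct l)
    case (Suc l)
    have "x i \<in> ?W" using that var var_closed by auto
    then show ?case using mult[OF Suc] by simp
  qed (use one in simp)
  have "pbw_monomial A x m \<alpha> \<in> ?W" if "m \<le> n" for m \<alpha>
    using that
  proof (induct m)
    case (Suc m)
    then show ?case unfolding pbw_monomial.simps by (intro mult pow) auto
  qed (use one in simp)
  then have mon: "pbw_monomial A x n \<alpha> \<in> ?W" for \<alpha> by simp
  have "carrier A \<subseteq> ?W"
  proof (rule span_induct)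
    show "\<zero> \<in> ?W" using S_closed additive_subgroup.zero_closed[OF S] by (auto simp: zero_smult)
    show "a \<oplus> b \<in> ?W" if "a \<in> ?W" "b \<in> ?W" for a b
      using that S_closed additive_subgroup.a_closed[OF S] by (auto simp: lsmult_l_distr)
    show "r \<otimes> pbw_monomial A x n \<alpha> \<in> ?W" if "r \<in> K" for r \<alpha>
      by (rule mult[OF _ mon]) (use that K K_closed in auto)
  qed auto
  then show ?thesis using a u by blast
qed

text \<open>
  This is where cyclicity enters.  If all variables kept \<open>e\<close> in \<open>F (Suc k)\<close>, then \<open>F (Suc k)\<close>, which is
  \<open>F k\<close> plus the line through \<open>e\<close>, would be stable under all of \<open>A\<close>.  It contains the generator in
  degree \<open>0\<close>, so it would be all of \<open>M\<close>; but \<open>M\<close> is nonzero in degree \<open>k + 1\<close>.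
\<close>

lemma var_raises_degree:
  assumes e: "e \<in> F (Suc k) - F k"
  shows "\<exists>i \<in> {1..n}. x i \<odot>\<^bsub>M\<^esub> e \<notin> F (Suc k)"
proof (rule ccontr)
  assume "\<not> (\<exists>i \<in> {1..n}. x i \<odot>\<^bsub>M\<^esub> e \<notin> F (Suc k))"
  then have xe: "x i \<odot>\<^bsub>M\<^esub> e \<in> F (Suc k)" if "i \<in> {1..n}" for i using that by blast
  have e_closed: "e \<in> carrier M" using e F_mem by blast
  have var: "x i \<odot>\<^bsub>M\<^esub> u \<in> F (Suc k)" if i: "i \<in> {1..n}" and u: "u \<in> F (Suc k)" for i u
  proof -
    obtain r where r: "r \<in> K" "u \<ominus>\<^bsub>M\<^esub> r \<odot>\<^bsub>M\<^esub> e \<in> F k" using F_quotient_line[OF e u] by blast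
    note [simp] = K_closed[OF r(1)] F_mem[OF u] var_closed[OF i] e_closed lsmult_closed
    have "x i \<odot>\<^bsub>M\<^esub> u \<ominus>\<^bsub>M\<^esub> r \<odot>\<^bsub>M\<^esub> (x i \<odot>\<^bsub>M\<^esub> e) \<in> F (Suc k)"
      using var_smult_F[OF i r(2)] by (simp add: smult_minus K_smult_commute[OF r(1)])
    then show ?thesis
      using M.cong_mem[OF F_subgroup] K_smult_F[OF r(1) xe[OF i]] by simp
  qed
  obtain m where m: "m \<in> MM 0" "carrier M = {a \<odot>\<^bsub>M\<^esub> m | a. a \<in> carrier A}" using cyclic by blast
  have "m \<in> F (Suc k)" using m(1) F_1 F_mono[of "Suc 0" "Suc k"] by auto
  then have "carrier M \<subseteq> F (Suc k)"
    using stable_smult[OF F_subgroup K_smult_F var] unfolding m(2) by blast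
  moreover obtain e' where "e' \<in> F (Suc (Suc k)) - F (Suc k)" using F_strict by blast
  ultimately show False using F_mem by blast
qed

text \<open>
  The lower order terms of the defining relations of \<open>A\<close> raise the degree by at most one, so they
  disappear in \<open>Gr\<close> next to the quadratic terms.
\<close>

lemma affine_span_smult_F:
  assumes "a \<in> affine_span A K n x" "u \<in> F k"
  shows "a \<odot>\<^bsub>M\<^esub> u \<in> F (Suc k)"
proof -
  let ?W = "{a \<in> carrier A. a \<odot>\<^bsub>M\<^esub> u \<in> F (Suc k)}"
  note [simp] = F_mem[OF assms(2)]
  have "affine_span A K n x \<subseteq> ?W"
  proof (rule affine_span_induct)
    show "K \<subseteq> ?W" using K_closed K_smult_F assms(2) F_step[of k] by auto
    show "r \<otimes> x i \<in> ?W" if "r \<in> K" "i \<in> {1..n}" for r i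
      using that K_closed var_closed K_smult_F var_smult_F[OF _ assms(2)] by (simp add: lsmult_assoc)
  qed (auto simp: zero_smult zero_F lsmult_l_distr add_F)
  then show ?thesis using assms(1) by blast
qed

end

section \<open>A point determines the graded module\<close>

text \<open>
  The multilinearized relations \<open>v'\<^sub>j v\<^sub>i = c\<^sub>i\<^sub>j v'\<^sub>i v\<^sub>j\<close> solved for the successor \<open>v'\<close> of \<open>v\<close>: an index \<open>i\<close>
  with \<open>v\<^sub>i\<close> nonzero is chosen, and the free scalar is fixed by putting \<open>v'\<^sub>i = 1\<close> on the right.
\<close>

definition next_coords ::
  "('a, 'c) ring_scheme \<Rightarrow> nat \<Rightarrow> (nat \<Rightarrow> nat \<Rightarrow> 'a) \<Rightarrow> (nat \<Rightarrow> 'a) \<Rightarrow> nat \<Rightarrow> 'a"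
where
  "next_coords A n c v =
     (let i = (SOME i. i \<in> {1..n} \<and> v i \<noteq> \<zero>\<^bsub>A\<^esub>)
      in (\<lambda>j. inv\<^bsub>A\<^esub> (v i) \<otimes>\<^bsub>A\<^esub> (c i j \<otimes>\<^bsub>A\<^esub> v j)))"

context PBW_point_module
begin

text \<open>
  Applying the relation between \<open>x\<^sub>j\<close> and \<open>x\<^sub>i\<close> to \<open>u\<close> gives \<open>v\<^sub>i x\<^sub>j w \<equiv> c\<^sub>i\<^sub>j v\<^sub>j x\<^sub>i w\<close> up to terms of lower
  degree.  When \<open>v\<^sub>i\<close> is nonzero, all vectors \<open>x\<^sub>j w\<close> are therefore multiples of \<open>x\<^sub>i w\<close>, with factors
  computed from \<open>v\<close> alone.  Since some \<open>x\<^sub>j w\<close> has full degree, so has \<open>x\<^sub>i w\<close>, and it can be taken as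
  the next basis vector.
\<close>

lemma leading_coords_next:
  assumes rel: "relation_constants A K n x c" and v: "v \<in> {1..n} \<rightarrow> K"
    and lead: "leading_coords A n x M MM k v u w"
  shows "next_coords A n c v \<in> {1..n} \<rightarrow> K"
    and "\<exists>w'. leading_coords A n x M MM (Suc k) (next_coords A n c v) w w'"
proof -
  have u: "u \<in> F (Suc k) - F k" and w: "w \<in> F (Suc (Suc k)) - F (Suc k)"
    and xu: "x i \<odot>\<^bsub>M\<^esub> u \<ominus>\<^bsub>M\<^esub> v i \<odot>\<^bsub>M\<^esub> w \<in> F (Suc k)" if "i \<in> {1..n}" for i
    using lead that unfolding leading_coords_def by auto
  have u': "u \<in> F (Suc k)" and w': "w \<in> F (Suc (Suc k))" and w'': "w \<notin> F (Suc k)"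
    using lead unfolding leading_coords_def by auto
  note [simp] = F_mem[OF u'] F_mem[OF w'] lsmult_closed
  define i where "i = (SOME i. i \<in> {1..n} \<and> v i \<noteq> \<zero>)"
  have "\<exists>i. i \<in> {1..n} \<and> v i \<noteq> \<zero>"
  proof -
    obtain i where i: "i \<in> {1..n}" "x i \<odot>\<^bsub>M\<^esub> u \<notin> F (Suc k)"
      using var_raises_degree[of u k] lead unfolding leading_coords_def by blast
    have "x i \<odot>\<^bsub>M\<^esub> u \<ominus>\<^bsub>M\<^esub> \<zero>\<^bsub>M\<^esub> = x i \<odot>\<^bsub>M\<^esub> u"
      using var_closed[OF i(1)] by (simp add: a_minus_def)
    then have "v i \<noteq> \<zero>" using xu[OF i(1)] i(2) by (auto simp: zero_smult)
    then show ?thesis using i(1) by blast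
  qed
  then have i: "i \<in> {1..n}" "v i \<noteq> \<zero>" unfolding i_def by (metis (mono_tags, lifting) someI_ex)+
  have vK: "v j \<in> K" if "j \<in> {1..n}" for j using v that by auto
  have cK: "c i j \<in> K" if "j \<in> {1..n}" for j
    using rel i(1) that unfolding relation_constants_def by blast
  let ?v' = "next_coords A n c v"
  have v': "?v' j = inv (v i) \<otimes> (c i j \<otimes> v j)" for j
    unfolding next_coords_def i_def Let_def ..
  have v'K: "?v' j \<in> K" if "j \<in> {1..n}" for j
    unfolding v' using that by (intro K_mult K_inv vK cK i)
  then show "?v' \<in> {1..n} \<rightarrow> K" by auto
  note [simp] = K_closed[OF K_inv[OF vK[OF i(1)] i(2)]]
  let ?w = "x i \<odot>\<^bsub>M\<^esub> w"
  have key: "x j \<odot>\<^bsub>M\<^esub> w \<ominus>\<^bsub>M\<^esub> ?v' j \<odot>\<^bsub>M\<^esub> ?w \<in> F (Suc (Suc k))" if j: "j \<in> {1..n}" for j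
  proof -
    note [simp] = var_closed[OF i(1)] var_closed[OF j] K_closed[OF vK[OF i(1)]] K_closed[OF vK[OF j]]
      K_closed[OF cK[OF j]] K_closed[OF v'K[OF j]]
    \<comment> \<open>The two orders of multiplication, each evaluated through the action on \<open>u\<close>.\<close>
    have 1: "x j \<odot>\<^bsub>M\<^esub> (x i \<odot>\<^bsub>M\<^esub> u) \<ominus>\<^bsub>M\<^esub> v i \<odot>\<^bsub>M\<^esub> (x j \<odot>\<^bsub>M\<^esub> w) \<in> F (Suc (Suc k))"
      using var_smult_F[OF j xu[OF i(1)]] by (simp add: smult_minus K_smult_commute[OF vK[OF i(1)]])
    have 2: "c i j \<odot>\<^bsub>M\<^esub> (x i \<odot>\<^bsub>M\<^esub> (x j \<odot>\<^bsub>M\<^esub> u)) \<ominus>\<^bsub>M\<^esub> c i j \<odot>\<^bsub>M\<^esub> (v j \<odot>\<^bsub>M\<^esub> ?w) \<in> F (Suc (Suc k))"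
      using K_smult_F[OF cK[OF j] var_smult_F[OF i(1) xu[OF j]]] by (simp add: smult_minus K_smult_commute[OF vK[OF j]])
    have "(x j \<otimes> x i) \<ominus> (c i j \<otimes> x i \<otimes> x j) \<in> affine_span A K n x"
      using rel i(1) j unfolding relation_constants_def by blast
    then have "((x j \<otimes> x i) \<ominus> (c i j \<otimes> x i \<otimes> x j)) \<odot>\<^bsub>M\<^esub> u \<in> F (Suc (Suc k))"
      by (rule affine_span_smult_F[OF _ u'])
    then have 3: "x j \<odot>\<^bsub>M\<^esub> (x i \<odot>\<^bsub>M\<^esub> u) \<ominus>\<^bsub>M\<^esub> c i j \<odot>\<^bsub>M\<^esub> (x i \<odot>\<^bsub>M\<^esub> (x j \<odot>\<^bsub>M\<^esub> u)) \<in> F (Suc (Suc k))"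
      by (simp add: minus_smult lsmult_assoc)
    have "v i \<odot>\<^bsub>M\<^esub> (x j \<odot>\<^bsub>M\<^esub> w) \<ominus>\<^bsub>M\<^esub> c i j \<odot>\<^bsub>M\<^esub> (v j \<odot>\<^bsub>M\<^esub> ?w) \<in> F (Suc (Suc k))"
      using M.cong_mem[OF F_subgroup M.cong_minus[OF F_subgroup 1 2]] 3 by simp
    then have "inv (v i) \<odot>\<^bsub>M\<^esub> (v i \<odot>\<^bsub>M\<^esub> (x j \<odot>\<^bsub>M\<^esub> w) \<ominus>\<^bsub>M\<^esub> c i j \<odot>\<^bsub>M\<^esub> (v j \<odot>\<^bsub>M\<^esub> ?w)) \<in> F (Suc (Suc k))"
      by (rule K_smult_F[OF K_inv[OF vK[OF i(1)] i(2)]])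
    then show ?thesis
      unfolding v' using inv_smult_cancel[OF vK[OF i(1)] i(2), of "x j \<odot>\<^bsub>M\<^esub> w"]
      by (simp add: smult_minus lsmult_assoc)
  qed
  have "?w \<notin> F (Suc (Suc k))"
  proof
    assume "?w \<in> F (Suc (Suc k))"
    then have "?v' j \<odot>\<^bsub>M\<^esub> ?w \<in> F (Suc (Suc k))" if "j \<in> {1..n}" for j
      by (rule K_smult_F[OF v'K[OF that]])
    then have "x j \<odot>\<^bsub>M\<^esub> w \<in> F (Suc (Suc k))" if "j \<in> {1..n}" for j
      using M.cong_mem[OF F_subgroup key[OF that]] K_closed[OF v'K[OF that]]
        var_closed[OF that] var_closed[OF i(1)] that by simp
    then show False using var_raises_degree[of w "Suc k"] w' w'' by blast
  qed
  then have "leading_coords A n x M MM (Suc k) ?v' w ?w"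
    using w' w'' var_smult_F[OF i(1) w'] key unfolding leading_coords_def by blast
  then show "\<exists>w'. leading_coords A n x M MM (Suc k) ?v' w w'" by blast
qed

text \<open>
  Iterating the previous lemma gives basis vectors in all degrees on which the variables act through
  coordinates depending on \<open>v\<close> only.
\<close>

lemma leading_coords_sequence:
  assumes rel: "relation_constants A K n x c" and v: "v \<in> {1..n} \<rightarrow> K"
    and lead: "leading_coords A n x M MM 0 v u w"
  obtains e where "\<And>k. leading_coords A n x M MM k ((next_coords A n c ^^ k) v) (e k) (e (Suc k))"
proof -
  let ?P = "\<lambda>k p. (next_coords A n c ^^ k) v \<in> {1..n} \<rightarrow> K \<and>
    leading_coords A n x M MM k ((next_coords A n c ^^ k) v) (fst p) (snd p)"
  have "\<exists>f. \<forall>k. ?P k (f k) \<and> fst (f (Suc k)) = snd (f k)"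
  proof (rule dependent_nat_choice)
    show "\<exists>p. ?P 0 p" using v lead by auto
    fix p k assume p: "?P k p"
    have "\<exists>w'. leading_coords A n x M MM (Suc k) ((next_coords A n c ^^ Suc k) v) (snd p) w'"
      using leading_coords_next(2)[OF rel p[THEN conjunct1] p[THEN conjunct2]] by simp
    then obtain w' where "leading_coords A n x M MM (Suc k) ((next_coords A n c ^^ Suc k) v) (snd p) w'"
      by (rule exE)
    moreover have "(next_coords A n c ^^ Suc k) v \<in> {1..n} \<rightarrow> K"
      using leading_coords_next(1)[OF rel p[THEN conjunct1] p[THEN conjunct2]] by simp
    ultimately show "\<exists>q. ?P (Suc k) q \<and> fst q = snd p"
      by (intro exI[of _ "(snd p, w')"]) simp
  qed
  then obtain f where f: "\<And>k. ?P k (f k)" "\<And>k. fst (f (Suc k)) = snd (f k)" by blast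
  have "leading_coords A n x M MM k ((next_coords A n c ^^ k) v) (fst (f k)) (fst (f (Suc k)))" for k
    using f(1)[of k] unfolding f(2) by blast
  then show thesis by (rule that)
qed

lemma next_coords_iterate_closed:
  assumes rel: "relation_constants A K n x c" and v: "v \<in> {1..n} \<rightarrow> K"
    and lead: "\<And>k. leading_coords A n x M MM k ((next_coords A n c ^^ k) v) (e k) (e (Suc k))"
  shows "(next_coords A n c ^^ k) v \<in> {1..n} \<rightarrow> K"
proof (induct k)
  case (Suc k)
  show ?case using leading_coords_next(1)[OF rel Suc lead] by simp
qed (use v in simp)

lemma multiple_mem_F_iff:
  assumes "e \<in> F (Suc k) - F k" "t \<in> K" "u \<in> F (Suc k)" "u \<ominus>\<^bsub>M\<^esub> t \<odot>\<^bsub>M\<^esub> e \<in> F k"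
  shows "u \<in> F k \<longleftrightarrow> t = \<zero>"
proof -
  have e: "e \<in> carrier M" using assms(1) F_mem by blast
  have "u \<in> F k \<longleftrightarrow> t \<odot>\<^bsub>M\<^esub> e \<in> F k"
    using M.cong_mem[OF F_subgroup assms(4)] F_mem[OF assms(3)] e K_closed[OF assms(2)] by (simp add: lsmult_closed)
  also have "\<dots> \<longleftrightarrow> t = \<zero>"
    using smult_mem_F_iff[OF assms(2) _ e, of k] assms(1) zero_F e by (cases "t = \<zero>") (simp_all add: zero_smult)
  finally show ?thesis .
qed

lemma var_leading:
  assumes "leading_coords A n x M MM k v e w" "v \<in> {1..n} \<rightarrow> K" "i \<in> {1..n}" "t \<in> K" "u \<in> F (Suc k)"
    and ut: "u \<ominus>\<^bsub>M\<^esub> t \<odot>\<^bsub>M\<^esub> e \<in> F k"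
  shows "x i \<odot>\<^bsub>M\<^esub> u \<ominus>\<^bsub>M\<^esub> (t \<otimes> v i) \<odot>\<^bsub>M\<^esub> w \<in> F (Suc k)"
proof -
  have e: "e \<in> carrier M" and w: "w \<in> carrier M"
    and xe: "x i \<odot>\<^bsub>M\<^esub> e \<ominus>\<^bsub>M\<^esub> v i \<odot>\<^bsub>M\<^esub> w \<in> F (Suc k)"
    using assms(1,3) F_mem unfolding leading_coords_def by blast+
  have "v i \<in> carrier A" using funcset_mem[OF assms(2,3)] by (rule K_closed)
  note [simp] = e w this K_closed[OF assms(4)] var_closed[OF assms(3)] F_mem[OF assms(5)] lsmult_closed
  have 1: "x i \<odot>\<^bsub>M\<^esub> u \<ominus>\<^bsub>M\<^esub> t \<odot>\<^bsub>M\<^esub> (x i \<odot>\<^bsub>M\<^esub> e) \<in> F (Suc k)"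
    using var_smult_F[OF assms(3) ut] by (simp add: smult_minus K_smult_commute[OF assms(4)])
  have 2: "t \<odot>\<^bsub>M\<^esub> (x i \<odot>\<^bsub>M\<^esub> e) \<ominus>\<^bsub>M\<^esub> (t \<otimes> v i) \<odot>\<^bsub>M\<^esub> w \<in> F (Suc k)"
    using K_smult_F[OF assms(4) xe] by (simp add: smult_minus lsmult_assoc)
  show ?thesis by (rule M.cong_trans[OF F_subgroup 1 2]) simp_all
qed

end

text \<open>
  Two point modules with bases of their associated graded modules on which the variables act by the
  same coordinates.  Matching these bases gives the correspondence \<open>T\<close>.
\<close>

locale matched_point_modules =
  M: PBW_point_module A K n x M MM + N: PBW_point_module A K n x N NN
  for A :: "('a, 'c) ring_scheme" (structure) and K n x
    and M :: "('a, 'm, 'd) module_scheme" and MM :: "nat \<Rightarrow> 'm set"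
    and N :: "('a, 'l, 'e) module_scheme" and NN :: "nat \<Rightarrow> 'l set" +
  fixes v :: "nat \<Rightarrow> nat \<Rightarrow> 'a" and e :: "nat \<Rightarrow> 'm" and e' :: "nat \<Rightarrow> 'l"
  assumes v: "v k \<in> {1..n} \<rightarrow> K"
    and lead: "leading_coords A n x M MM k (v k) (e k) (e (Suc k))"
    and lead': "leading_coords A n x N NN k (v k) (e' k) (e' (Suc k))"
begin

definition T :: "nat \<Rightarrow> ('m \<times> 'l) set" where
  "T k = {(u, w). u \<in> M.F (Suc k) \<and> w \<in> N.F (Suc k) \<and>
     (\<exists>t \<in> K. u \<ominus>\<^bsub>M\<^esub> t \<odot>\<^bsub>M\<^esub> e k \<in> M.F k \<and> w \<ominus>\<^bsub>N\<^esub> t \<odot>\<^bsub>N\<^esub> e' k \<in> N.F k)}"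

lemma e: "e k \<in> M.F (Suc k) - M.F k" and e': "e' k \<in> N.F (Suc k) - N.F k"
  using lead lead' unfolding leading_coords_def by blast+

lemma e_closed: "e k \<in> carrier M" and e'_closed: "e' k \<in> carrier N"
  using e e' M.F_mem N.F_mem by blast+

lemma T_I:
  "\<lbrakk>u \<in> M.F (Suc k); w \<in> N.F (Suc k); t \<in> K; u \<ominus>\<^bsub>M\<^esub> t \<odot>\<^bsub>M\<^esub> e k \<in> M.F k;
    w \<ominus>\<^bsub>N\<^esub> t \<odot>\<^bsub>N\<^esub> e' k \<in> N.F k\<rbrakk> \<Longrightarrow> (u, w) \<in> T k"
  unfolding T_def by blast

lemma T_E:
  assumes "(u, w) \<in> T k"
  obtains t where "u \<in> M.F (Suc k)" "w \<in> N.F (Suc k)" "t \<in> K"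
    "u \<ominus>\<^bsub>M\<^esub> t \<odot>\<^bsub>M\<^esub> e k \<in> M.F k" "w \<ominus>\<^bsub>N\<^esub> t \<odot>\<^bsub>N\<^esub> e' k \<in> N.F k"
  using assms unfolding T_def by blast

lemma T_closed: "(u, w) \<in> T k \<Longrightarrow> u \<in> carrier M" "(u, w) \<in> T k \<Longrightarrow> w \<in> carrier N"
  using M.F_mem N.F_mem unfolding T_def by blast+

lemma T_add:
  assumes "(u, w) \<in> T k" "(u', w') \<in> T k"
  shows "(u \<oplus>\<^bsub>M\<^esub> u', w \<oplus>\<^bsub>N\<^esub> w') \<in> T k"
proof -
  obtain t where t: "u \<in> M.F (Suc k)" "w \<in> N.F (Suc k)" "t \<in> K"
    "u \<ominus>\<^bsub>M\<^esub> t \<odot>\<^bsub>M\<^esub> e k \<in> M.F k" "w \<ominus>\<^bsub>N\<^esub> t \<odot>\<^bsub>N\<^esub> e' k \<in> N.F k"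
    using assms(1) by (rule T_E)
  obtain s where s: "u' \<in> M.F (Suc k)" "w' \<in> N.F (Suc k)" "s \<in> K"
    "u' \<ominus>\<^bsub>M\<^esub> s \<odot>\<^bsub>M\<^esub> e k \<in> M.F k" "w' \<ominus>\<^bsub>N\<^esub> s \<odot>\<^bsub>N\<^esub> e' k \<in> N.F k"
    using assms(2) by (rule T_E)
  note [simp] = M.K_closed[OF s(3)] M.K_closed[OF t(3)] e_closed e'_closed M.lsmult_closed N.lsmult_closed
    T_closed[OF assms(1)] T_closed[OF assms(2)]
  show ?thesis
  proof (rule T_I)
    show "t \<oplus> s \<in> K" using s t by (intro M.K_add)
    show "u \<oplus>\<^bsub>M\<^esub> u' \<ominus>\<^bsub>M\<^esub> (t \<oplus> s) \<odot>\<^bsub>M\<^esub> e k \<in> M.F k"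
      using M.M.cong_add[OF M.F_subgroup t(4) s(4)] by (simp add: M.lsmult_l_distr)
    show "w \<oplus>\<^bsub>N\<^esub> w' \<ominus>\<^bsub>N\<^esub> (t \<oplus> s) \<odot>\<^bsub>N\<^esub> e' k \<in> N.F k"
      using N.M.cong_add[OF N.F_subgroup t(5) s(5)] by (simp add: N.lsmult_l_distr)
  qed (use s t M.add_F N.add_F in blast)+
qed

lemma T_minus:
  assumes "(u, w) \<in> T k" "(u', w') \<in> T k"
  shows "(u \<ominus>\<^bsub>M\<^esub> u', w \<ominus>\<^bsub>N\<^esub> w') \<in> T k"
proof -
  obtain t where t: "u \<in> M.F (Suc k)" "w \<in> N.F (Suc k)" "t \<in> K"
    "u \<ominus>\<^bsub>M\<^esub> t \<odot>\<^bsub>M\<^esub> e k \<in> M.F k" "w \<ominus>\<^bsub>N\<^esub> t \<odot>\<^bsub>N\<^esub> e' k \<in> N.F k"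
    using assms(1) by (rule T_E)
  obtain s where s: "u' \<in> M.F (Suc k)" "w' \<in> N.F (Suc k)" "s \<in> K"
    "u' \<ominus>\<^bsub>M\<^esub> s \<odot>\<^bsub>M\<^esub> e k \<in> M.F k" "w' \<ominus>\<^bsub>N\<^esub> s \<odot>\<^bsub>N\<^esub> e' k \<in> N.F k"
    using assms(2) by (rule T_E)
  note [simp] = M.K_closed[OF s(3)] M.K_closed[OF t(3)] e_closed e'_closed M.lsmult_closed N.lsmult_closed
    T_closed[OF assms(1)] T_closed[OF assms(2)]
  show ?thesis
  proof (rule T_I)
    show "t \<ominus> s \<in> K" using s t by (intro M.K_minus)
    show "u \<ominus>\<^bsub>M\<^esub> u' \<ominus>\<^bsub>M\<^esub> (t \<ominus> s) \<odot>\<^bsub>M\<^esub> e k \<in> M.F k"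
      using M.M.cong_minus[OF M.F_subgroup t(4) s(4)] by (simp add: M.minus_smult)
    show "w \<ominus>\<^bsub>N\<^esub> w' \<ominus>\<^bsub>N\<^esub> (t \<ominus> s) \<odot>\<^bsub>N\<^esub> e' k \<in> N.F k"
      using N.M.cong_minus[OF N.F_subgroup t(5) s(5)] by (simp add: N.minus_smult)
  qed (use s t M.minus_F N.minus_F in blast)+
qed

lemma T_lower:
  assumes "u \<in> M.F k" "w \<in> N.F k"
  shows "(u, w) \<in> T k"
proof (rule T_I[where t = "\<zero>"])
  show "u \<ominus>\<^bsub>M\<^esub> \<zero> \<odot>\<^bsub>M\<^esub> e k \<in> M.F k" "w \<ominus>\<^bsub>N\<^esub> \<zero> \<odot>\<^bsub>N\<^esub> e' k \<in> N.F k"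
    using assms M.zero_F N.zero_F
    by (auto simp: M.zero_smult N.zero_smult e_closed e'_closed intro!: M.minus_F N.minus_F)
qed (use assms M.F_step N.F_step M.K_zero in blast)+

lemma T_left: "u \<in> M.F (Suc k) \<Longrightarrow> \<exists>w. (u, w) \<in> T k"
proof -
  assume u: "u \<in> M.F (Suc k)"
  obtain t where t: "t \<in> K" "u \<ominus>\<^bsub>M\<^esub> t \<odot>\<^bsub>M\<^esub> e k \<in> M.F k" using M.F_quotient_line[OF e u] by blast
  have w: "t \<odot>\<^bsub>N\<^esub> e' k \<in> N.F (Suc k)" using e'[of k] N.K_smult_F[OF t(1)] by blast
  have "t \<odot>\<^bsub>N\<^esub> e' k \<ominus>\<^bsub>N\<^esub> t \<odot>\<^bsub>N\<^esub> e' k = \<zero>\<^bsub>N\<^esub>" using N.F_mem[OF w] by (simp add: a_minus_def N.M.r_neg)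
  then show ?thesis using T_I[OF u w t] N.zero_F by auto
qed

lemma T_right: "w \<in> N.F (Suc k) \<Longrightarrow> \<exists>u. (u, w) \<in> T k"
proof -
  assume w: "w \<in> N.F (Suc k)"
  obtain t where t: "t \<in> K" "w \<ominus>\<^bsub>N\<^esub> t \<odot>\<^bsub>N\<^esub> e' k \<in> N.F k" using N.F_quotient_line[OF e' w] by blast
  have u: "t \<odot>\<^bsub>M\<^esub> e k \<in> M.F (Suc k)" using e[of k] M.K_smult_F[OF t(1)] by blast
  have "t \<odot>\<^bsub>M\<^esub> e k \<ominus>\<^bsub>M\<^esub> t \<odot>\<^bsub>M\<^esub> e k = \<zero>\<^bsub>M\<^esub>" using M.F_mem[OF u] by (simp add: a_minus_def M.M.r_neg)
  then show ?thesis using T_I[OF u w t(1) _ t(2)] M.zero_F by auto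
qed

text \<open>
  The elements of \<open>A\<close> that respect the correspondence while raising the degree by \<open>p\<close>.  Scalars and
  variables are among them, the degrees add up in products, and so every element of degree at most \<open>p\<close>
  is reached through the monomials.
\<close>

definition W :: "nat \<Rightarrow> 'a set" where
  "W p = {a \<in> carrier A. \<forall>q u w. (u, w) \<in> T q \<longrightarrow> (a \<odot>\<^bsub>M\<^esub> u, a \<odot>\<^bsub>N\<^esub> w) \<in> T (p + q)}"

lemma W_I:
  "\<lbrakk>a \<in> carrier A; \<And>q u w. (u, w) \<in> T q \<Longrightarrow> (a \<odot>\<^bsub>M\<^esub> u, a \<odot>\<^bsub>N\<^esub> w) \<in> T (p + q)\<rbrakk> \<Longrightarrow> a \<in> W p"
  unfolding W_def by blast

lemma W_D: "a \<in> W p \<Longrightarrow> (u, w) \<in> T q \<Longrightarrow> (a \<odot>\<^bsub>M\<^esub> u, a \<odot>\<^bsub>N\<^esub> w) \<in> T (p + q)"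
  and W_closed: "a \<in> W p \<Longrightarrow> a \<in> carrier A"
  unfolding W_def by blast+

lemma W_mult:
  assumes "a \<in> W p" "b \<in> W q"
  shows "a \<otimes> b \<in> W (p + q)"
proof (rule W_I)
  show "a \<otimes> b \<in> carrier A" using assms W_closed by auto
  fix r u w assume uw: "(u, w) \<in> T r"
  show "((a \<otimes> b) \<odot>\<^bsub>M\<^esub> u, (a \<otimes> b) \<odot>\<^bsub>N\<^esub> w) \<in> T (p + q + r)"
    using W_D[OF assms(1) W_D[OF assms(2) uw]] W_closed[OF assms(1)] W_closed[OF assms(2)] T_closed[OF uw]
    by (simp add: M.lsmult_assoc N.lsmult_assoc add.assoc)
qed

lemma W_add:
  assumes "a \<in> W p" "b \<in> W p"
  shows "a \<oplus> b \<in> W p"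
proof (rule W_I)
  show "a \<oplus> b \<in> carrier A" using assms W_closed by auto
  fix r u w assume uw: "(u, w) \<in> T r"
  show "((a \<oplus> b) \<odot>\<^bsub>M\<^esub> u, (a \<oplus> b) \<odot>\<^bsub>N\<^esub> w) \<in> T (p + r)"
    using T_add[OF W_D[OF assms(1) uw] W_D[OF assms(2) uw]] W_closed[OF assms(1)] W_closed[OF assms(2)] T_closed[OF uw]
    by (simp add: M.lsmult_l_distr N.lsmult_l_distr)
qed

lemma W_K:
  assumes "r \<in> K"
  shows "r \<in> W 0"
proof (rule W_I)
  show "r \<in> carrier A" using assms by (rule M.K_closed)
  fix q u w assume uw: "(u, w) \<in> T q"
  then obtain t where t: "u \<in> M.F (Suc q)" "w \<in> N.F (Suc q)" "t \<in> K"
    "u \<ominus>\<^bsub>M\<^esub> t \<odot>\<^bsub>M\<^esub> e q \<in> M.F q" "w \<ominus>\<^bsub>N\<^esub> t \<odot>\<^bsub>N\<^esub> e' q \<in> N.F q"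
    by (rule T_E)
  note [simp] = M.K_closed[OF assms] M.K_closed[OF t(3)] e_closed e'_closed M.lsmult_closed N.lsmult_closed
    T_closed[OF uw]
  show "(r \<odot>\<^bsub>M\<^esub> u, r \<odot>\<^bsub>N\<^esub> w) \<in> T (0 + q)" unfolding add_0
  proof (rule T_I)
    show "r \<otimes> t \<in> K" using assms t(3) by (rule M.K_mult)
    show "r \<odot>\<^bsub>M\<^esub> u \<ominus>\<^bsub>M\<^esub> (r \<otimes> t) \<odot>\<^bsub>M\<^esub> e q \<in> M.F q"
      using M.K_smult_F[OF assms t(4)] by (simp add: M.smult_minus M.lsmult_assoc)
    show "r \<odot>\<^bsub>N\<^esub> w \<ominus>\<^bsub>N\<^esub> (r \<otimes> t) \<odot>\<^bsub>N\<^esub> e' q \<in> N.F q"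
      using N.K_smult_F[OF assms t(5)] by (simp add: N.smult_minus N.lsmult_assoc)
  qed (use t assms M.K_smult_F N.K_smult_F in blast)+
qed

lemma W_var:
  assumes i: "i \<in> {1..n}"
  shows "x i \<in> W (Suc 0)"
proof (rule W_I)
  show "x i \<in> carrier A" using i by (rule M.var_closed)
  fix q u w assume "(u, w) \<in> T q"
  then obtain t where t: "u \<in> M.F (Suc q)" "w \<in> N.F (Suc q)" "t \<in> K"
    "u \<ominus>\<^bsub>M\<^esub> t \<odot>\<^bsub>M\<^esub> e q \<in> M.F q" "w \<ominus>\<^bsub>N\<^esub> t \<odot>\<^bsub>N\<^esub> e' q \<in> N.F q"
    by (rule T_E)
  have "(x i \<odot>\<^bsub>M\<^esub> u, x i \<odot>\<^bsub>N\<^esub> w) \<in> T (Suc q)"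
  proof (rule T_I)
    show "t \<otimes> v q i \<in> K" using t(3) i v[of q] by (intro M.K_mult) auto
    show "x i \<odot>\<^bsub>M\<^esub> u \<ominus>\<^bsub>M\<^esub> (t \<otimes> v q i) \<odot>\<^bsub>M\<^esub> e (Suc q) \<in> M.F (Suc q)"
      by (rule M.var_leading[OF lead v i t(3,1,4)])
    show "x i \<odot>\<^bsub>N\<^esub> w \<ominus>\<^bsub>N\<^esub> (t \<otimes> v q i) \<odot>\<^bsub>N\<^esub> e' (Suc q) \<in> N.F (Suc q)"
      by (rule N.var_leading[OF lead' v i t(3,2,5)])
  qed (use t i M.var_smult_F N.var_smult_F in blast)+
  then show "(x i \<odot>\<^bsub>M\<^esub> u, x i \<odot>\<^bsub>N\<^esub> w) \<in> T (Suc 0 + q)" by simp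
qed

lemma W_pow: "i \<in> {1..n} \<Longrightarrow> x i [^] (l::nat) \<in> W l"
proof (induct l)
  case 0
  then show ?case using W_K[OF M.K_one] by simp
next
  case (Suc l)
  then show ?case using W_mult[OF Suc(1) W_var, of i] by simp
qed

lemma W_monomial: "m \<le> n \<Longrightarrow> pbw_monomial A x m \<alpha> \<in> W (\<Sum>i = 1..m. \<alpha> i)"
proof (induct m)
  case 0
  then show ?case using W_K[OF M.K_one] by simp
next
  case (Suc m)
  have "pbw_monomial A x m \<alpha> \<otimes> x (Suc m) [^] \<alpha> (Suc m) \<in> W ((\<Sum>i = 1..m. \<alpha> i) + \<alpha> (Suc m))"
    using Suc by (intro W_mult W_pow) auto
  then show ?case by simp
qed

lemma W_zero: "\<zero> \<in> W p"
  by (rule W_I) (auto simp: M.zero_smult N.zero_smult T_closed intro!: T_lower M.zero_F N.zero_F)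

lemma piece_W: "pbw_piece A K n x p \<subseteq> W p"
proof (rule M.piece_induct)
  show "r \<otimes> pbw_monomial A x n \<alpha> \<in> W p" if "r \<in> K" "(\<Sum>i = 1..n. \<alpha> i) = p" for r \<alpha>
    using W_mult[OF W_K[OF that(1)] W_monomial[OF order_refl, of \<alpha>]] that(2) by simp
qed (use W_closed W_zero W_add in auto)

lemma B_W:
  assumes "a \<in> M.B (Suc p)"
  shows "a \<in> W p"
proof -
  obtain b s where b: "b \<in> pbw_piece A K n x p" "s \<in> M.B p" "a = b \<oplus> s"
    using assms unfolding M.B_Suc by blast
  have "s \<in> W p"
  proof (rule W_I)
    show "s \<in> carrier A" using b(2) by (rule M.B_mem)
    fix q u w assume "(u, w) \<in> T q"
    then have "u \<in> M.F (Suc q)" "w \<in> N.F (Suc q)" by (auto elim: T_E)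
    then show "(s \<odot>\<^bsub>M\<^esub> u, s \<odot>\<^bsub>N\<^esub> w) \<in> T (p + q)"
      using b(2) by (intro T_lower M.B_smult_F N.B_smult_F)
  qed
  then show ?thesis unfolding b(3) using b(1) piece_W by (intro W_add) auto
qed

lemma gr_correspondence: "gr_correspondence A M N (pbw_piece A K n x) MM NN T"
proof (unfold_locales)
  fix k u w assume uw: "(u, w) \<in> T k"
  then obtain t where t: "u \<in> M.F (Suc k)" "w \<in> N.F (Suc k)" "t \<in> K"
    "u \<ominus>\<^bsub>M\<^esub> t \<odot>\<^bsub>M\<^esub> e k \<in> M.F k" "w \<ominus>\<^bsub>N\<^esub> t \<odot>\<^bsub>N\<^esub> e' k \<in> N.F k"
    by (rule T_E)
  show "u \<in> M.F k \<longleftrightarrow> w \<in> N.F k"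
    using M.multiple_mem_F_iff[OF e t(3,1,4)] N.multiple_mem_F_iff[OF e' t(3,2,5)] by simp
  show "(u \<oplus>\<^bsub>M\<^esub> u', w \<oplus>\<^bsub>N\<^esub> w') \<in> T k" "(u \<ominus>\<^bsub>M\<^esub> u', w \<ominus>\<^bsub>N\<^esub> w') \<in> T k"
    if "(u', w') \<in> T k" for u' w'
    by (rule T_add[OF uw that], rule T_minus[OF uw that])
  show "(a \<odot>\<^bsub>M\<^esub> u, a \<odot>\<^bsub>N\<^esub> w) \<in> T (p + k)" if "a \<in> M.B (Suc p)" for a p
    by (rule W_D[OF B_W[OF that] uw])
next
  show "T k \<subseteq> M.F (Suc k) \<times> N.F (Suc k)" for k unfolding T_def by blast
  show "(u, w) \<in> T k" if "u \<in> M.F k" "w \<in> N.F k" for u w k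
    using that by (rule T_lower)
  show "\<exists>w. (u, w) \<in> T k" if "u \<in> M.F (Suc k)" for u k using that by (rule T_left)
  show "\<exists>u. (u, w) \<in> T k" if "w \<in> N.F (Suc k)" for w k using that by (rule T_right)
qed

end

section \<open>Invariance of the point\<close>

text \<open>
  The relations \<open>x\<^sub>i e = v\<^sub>i e'\<close> are equations between homogeneous elements of \<open>Gr(M)\<close>, the scalars \<open>v\<^sub>i\<close>
  acting through the degree \<open>0\<close> part of \<open>Gr(A)\<close>, so a graded isomorphism transports them.  It sends zero
  to zero, because zero is the zero scalar times any element, and by injectivity nothing else.
\<close>

lemma gr_isomorphism_leading_coords:
  assumes "semi_graded A M AA MM" "semi_graded A N AA NN"
    and iso: "graded_isomorphic (gr_ring A AA) (gr_module M MM) (gr_homogeneous M MM)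
      (gr_module N NN) (gr_homogeneous N NN)"
    and x: "\<And>i. i \<in> {1..n} \<Longrightarrow> x i \<in> AA (Suc 0)" and v: "\<And>i. i \<in> {1..n} \<Longrightarrow> v i \<in> AA 0"
    and lead: "leading_coords A n x M MM k v u w"
  shows "\<exists>u' w'. leading_coords A n x N NN k v u' w'"
proof -
  interpret M: semi_graded A M AA MM by fact
  interpret N: semi_graded A N AA NN by fact
  obtain f where f: "f \<in> left_module_iso (gr_ring A AA) (gr_module M MM) (gr_module N NN)"
    and f_homogeneous: "\<And>k. f ` gr_homogeneous M MM k \<subseteq> gr_homogeneous N NN k"
    using iso unfolding graded_isomorphic_def by blast
  have inj: "inj_on f (gr_carrier M MM)"
    and f_smult: "\<And>a m. a \<in> carrier (gr_ring A AA) \<Longrightarrow> m \<in> gr_carrier M MM \<Longrightarrow>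
      f (a \<odot>\<^bsub>gr_module M MM\<^esub> m) = a \<odot>\<^bsub>gr_module N NN\<^esub> f m"
    using f unfolding left_module_iso_def iso_def bij_betw_def by (auto simp: gr_module_def)
  have elem_carrier: "gr_elem M MM k m \<in> gr_carrier M MM" if "m \<in> M.F (Suc k)" for k m
    using M.gr_elem_module[OF that] by (simp add: gr_homogeneous_def)
  have image: "\<exists>m'. m' \<in> N.F (Suc k) \<and> f (gr_elem M MM k m) = gr_elem N NN k m'" if "m \<in> M.F (Suc k)" for k m
  proof -
    have "f (gr_elem M MM k m) \<in> gr_homogeneous N NN k"
      using M.gr_elem_module[OF that] f_homogeneous by blast
    then show ?thesis using N.homogeneous_eq_gr_elem by metis
  qed
  have zeroA: "\<zero>\<^bsub>A\<^esub> \<in> M.B (Suc 0)" by (rule M.zero_B)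
  have nonzero: "m' \<notin> N.F k"
    if m: "m \<in> M.F (Suc k)" "m \<notin> M.F k" and m': "m' \<in> N.F (Suc k)" "f (gr_elem M MM k m) = gr_elem N NN k m'" for k m m'
  proof
    assume "m' \<in> N.F k"
    then have "gr_elem N NN k m' = gr_elem N NN k \<zero>\<^bsub>N\<^esub>"
      by (simp add: N.gr_elem_eq_iff N.F_mem N.minus_F N.zero_F)
    also have "\<dots> = gr_elem A AA 0 \<zero>\<^bsub>A\<^esub> \<odot>\<^bsub>gr_module N NN\<^esub> f (gr_elem M MM k m)"
      unfolding m'(2) N.gr_elem_smult[OF zeroA m'(1)] by (simp add: N.zero_smult N.F_mem[OF m'(1)])
    also have "\<dots> = f (gr_elem A AA 0 \<zero>\<^bsub>A\<^esub> \<odot>\<^bsub>gr_module M MM\<^esub> gr_elem M MM k m)"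
      by (rule f_smult[OF M.gr_elem_ring[OF zeroA] elem_carrier[OF m(1)], symmetric])
    also have "\<dots> = f (gr_elem M MM k \<zero>\<^bsub>M\<^esub>)"
      unfolding M.gr_elem_smult[OF zeroA m(1)] by (simp add: M.zero_smult M.F_mem[OF m(1)])
    finally have "gr_elem M MM k m = gr_elem M MM k \<zero>\<^bsub>M\<^esub>"
      unfolding m'(2)[symmetric] using inj_onD[OF inj] elem_carrier[OF m(1)] elem_carrier[OF M.zero_F] by blast
    then have "m \<ominus>\<^bsub>M\<^esub> \<zero>\<^bsub>M\<^esub> \<in> M.F k"
      using M.gr_elem_eq_iff[OF M.F_mem[OF m(1)] M.F_mem[OF M.zero_F]] by simp
    then have "m \<in> M.F k"
      using M.M.cong_mem[OF M.F_subgroup _ M.F_mem[OF m(1)] M.F_mem[OF M.zero_F]] M.zero_F by blast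
    then show False using m(2) by blast
  qed
  have u: "u \<in> M.F (Suc k)" "u \<notin> M.F k" and w: "w \<in> M.F (Suc (Suc k))" "w \<notin> M.F (Suc k)"
    and xu: "\<And>i. i \<in> {1..n} \<Longrightarrow> (x i \<odot>\<^bsub>M\<^esub> u) \<ominus>\<^bsub>M\<^esub> (v i \<odot>\<^bsub>M\<^esub> w) \<in> M.F (Suc k)"
    using lead unfolding leading_coords_def by blast+
  obtain u' where u': "u' \<in> N.F (Suc k)" "f (gr_elem M MM k u) = gr_elem N NN k u'"
    using image[OF u(1)] by blast
  obtain w' where w': "w' \<in> N.F (Suc (Suc k))" "f (gr_elem M MM (Suc k) w) = gr_elem N NN (Suc k) w'"
    using image[OF w(1)] by blast
  have "(x i \<odot>\<^bsub>N\<^esub> u') \<ominus>\<^bsub>N\<^esub> (v i \<odot>\<^bsub>N\<^esub> w') \<in> N.F (Suc k)" if i: "i \<in> {1..n}" for i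
  proof -
    have xB: "x i \<in> M.B (Suc (Suc 0))" and vB: "v i \<in> M.B (Suc 0)"
      using M.piece_B x[OF i] v[OF i] by blast+
    note [simp] = M.B_mem[OF xB] M.B_mem[OF vB] M.F_mem[OF u(1)] M.F_mem[OF w(1)]
      N.F_mem[OF u'(1)] N.F_mem[OF w'(1)] M.lsmult_closed N.lsmult_closed
    have "gr_elem A AA (Suc 0) (x i) \<odot>\<^bsub>gr_module M MM\<^esub> gr_elem M MM k u
      = gr_elem A AA 0 (v i) \<odot>\<^bsub>gr_module M MM\<^esub> gr_elem M MM (Suc k) w"
      unfolding M.gr_elem_smult[OF xB u(1)] M.gr_elem_smult[OF vB w(1)]
      using M.gr_elem_eq_iff[of "x i \<odot>\<^bsub>M\<^esub> u" "v i \<odot>\<^bsub>M\<^esub> w" "Suc k"] xu[OF i] by simp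
    then have "gr_elem A AA (Suc 0) (x i) \<odot>\<^bsub>gr_module N NN\<^esub> gr_elem N NN k u'
      = gr_elem A AA 0 (v i) \<odot>\<^bsub>gr_module N NN\<^esub> gr_elem N NN (Suc k) w'"
      using f_smult[OF M.gr_elem_ring[OF xB] elem_carrier[OF u(1)]]
        f_smult[OF M.gr_elem_ring[OF vB] elem_carrier[OF w(1)]] u'(2) w'(2) by simp
    then have "gr_elem N NN (Suc k) (x i \<odot>\<^bsub>N\<^esub> u') = gr_elem N NN (Suc k) (v i \<odot>\<^bsub>N\<^esub> w')"
      unfolding N.gr_elem_smult[OF xB u'(1)] N.gr_elem_smult[OF vB w'(1)] by simp
    then show ?thesis
      using N.gr_elem_eq_iff[of "x i \<odot>\<^bsub>N\<^esub> u'" "v i \<odot>\<^bsub>N\<^esub> w'" "Suc k"] by simp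
  qed
  then have "leading_coords A n x N NN k v u' w'"
    using u'(1) w'(1) nonzero[OF u u'] nonzero[OF w w'] unfolding leading_coords_def by blast
  then show ?thesis by blast
qed

text \<open>
  A graded isomorphism \<open>f\<close> maps each filtration step into the corresponding one.  It remains to see
  that \<open>f w\<close> does not drop to degree \<open>0\<close>: otherwise \<open>f w\<close> would be a multiple of \<open>f u\<close>, since degree \<open>0\<close>
  of \<open>N\<close> is a line, and by injectivity \<open>w\<close> would be a multiple of \<open>u\<close>.
\<close>

lemma isomorphism_leading_coords:
  assumes "PBW_point_module A K n x M MM" "PBW_point_module A K n x N NN"
    and iso: "graded_isomorphic A M MM N NN"
    and v: "v \<in> {1..n} \<rightarrow> K"
    and lead: "leading_coords A n x M MM 0 v u w"
  shows "\<exists>u' w'. leading_coords A n x N NN 0 v u' w'"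
proof -
  interpret M: PBW_point_module A K n x M MM by fact
  interpret N: PBW_point_module A K n x N NN by fact
  obtain f where f: "f \<in> left_module_iso A M N" and f_graded: "\<And>k. f ` MM k \<subseteq> NN k"
    using iso unfolding graded_isomorphic_def by blast
  have inj: "inj_on f (carrier M)"
    and f_closed: "\<And>m. m \<in> carrier M \<Longrightarrow> f m \<in> carrier N"
    and f_add: "\<And>m m'. m \<in> carrier M \<Longrightarrow> m' \<in> carrier M \<Longrightarrow> f (m \<oplus>\<^bsub>M\<^esub> m') = f m \<oplus>\<^bsub>N\<^esub> f m'"
    and f_smult: "\<And>a m. a \<in> carrier A \<Longrightarrow> m \<in> carrier M \<Longrightarrow> f (a \<odot>\<^bsub>M\<^esub> m) = a \<odot>\<^bsub>N\<^esub> f m"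
    using f unfolding left_module_iso_def iso_def bij_betw_def hom_def by auto
  have f_zero: "f \<zero>\<^bsub>M\<^esub> = \<zero>\<^bsub>N\<^esub>"
    using f_smult[OF M.K_closed[OF M.K_zero] M.M.zero_closed] f_closed[OF M.M.zero_closed]
    by (simp add: M.zero_smult N.zero_smult)
  have f_minus: "f (m \<ominus>\<^bsub>M\<^esub> m') = f m \<ominus>\<^bsub>N\<^esub> f m'" if "m \<in> carrier M" "m' \<in> carrier M" for m m'
  proof -
    have "f (\<ominus>\<^bsub>M\<^esub> m') \<oplus>\<^bsub>N\<^esub> f m' = \<zero>\<^bsub>N\<^esub>"
      using f_add[of "\<ominus>\<^bsub>M\<^esub> m'" m'] that by (simp add: M.M.l_neg f_zero)
    then have "f (\<ominus>\<^bsub>M\<^esub> m') = \<ominus>\<^bsub>N\<^esub> f m'"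
      using that f_closed by (intro N.M.minus_equality[symmetric]) auto
    then show ?thesis using that by (simp add: a_minus_def f_add)
  qed
  have f_F: "f m \<in> N.F k" if "m \<in> M.F k" for m k
    using that
  proof (induct k arbitrary: m)
    case (Suc k)
    then obtain b s where b: "b \<in> MM k" "s \<in> M.F k" "m = b \<oplus>\<^bsub>M\<^esub> s" unfolding M.F_Suc by blast
    have "f b \<in> NN k" using f_graded b(1) by blast
    then show ?case
      unfolding b(3) N.F_Suc using Suc.hyps[OF b(2)] f_add[OF M.component_mem[OF b(1)] M.F_mem[OF b(2)]] by blast
  qed (simp add: M.F_0 N.F_0 f_zero)
  have u: "u \<in> M.F (Suc 0)" "u \<notin> M.F 0" and w: "w \<in> M.F (Suc (Suc 0))" "w \<notin> M.F (Suc 0)"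
    and xu: "\<And>i. i \<in> {1..n} \<Longrightarrow> (x i \<odot>\<^bsub>M\<^esub> u) \<ominus>\<^bsub>M\<^esub> (v i \<odot>\<^bsub>M\<^esub> w) \<in> M.F (Suc 0)"
    using lead unfolding leading_coords_def by blast+
  note uw_closed = M.F_mem[OF u(1)] M.F_mem[OF w(1)]
  have "f u \<noteq> \<zero>\<^bsub>N\<^esub>"
    using u(2) inj_onD[OF inj, of u "\<zero>\<^bsub>M\<^esub>"] uw_closed f_zero by (auto simp: M.F_0)
  then have fu: "f u \<in> N.F (Suc 0) - N.F 0" using f_F[OF u(1)] by (simp add: N.F_0)
  have "f w \<notin> N.F (Suc 0)"
  proof
    assume "f w \<in> N.F (Suc 0)"
    then obtain r where r: "r \<in> K" "f w \<ominus>\<^bsub>N\<^esub> r \<odot>\<^bsub>N\<^esub> f u \<in> N.F 0"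
      using N.F_quotient_line[OF fu] by blast
    have ru: "r \<odot>\<^bsub>M\<^esub> u \<in> carrier M" using uw_closed M.K_closed[OF r(1)] by (simp add: M.lsmult_closed)
    have "f (w \<ominus>\<^bsub>M\<^esub> r \<odot>\<^bsub>M\<^esub> u) = f \<zero>\<^bsub>M\<^esub>"
      using r f_minus[OF uw_closed(2) ru] f_smult[OF M.K_closed[OF r(1)] uw_closed(1)] f_zero by (simp add: N.F_0)
    then have "w \<ominus>\<^bsub>M\<^esub> r \<odot>\<^bsub>M\<^esub> u = \<zero>\<^bsub>M\<^esub>"
      using inj_onD[OF inj] ru uw_closed by blast
    then have "w \<in> M.F (Suc 0) \<longleftrightarrow> r \<odot>\<^bsub>M\<^esub> u \<in> M.F (Suc 0)"
      using M.zero_F by (intro M.M.cong_mem[OF M.F_subgroup _ uw_closed(2) ru]) simp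
    then show False using w(2) M.K_smult_F[OF r(1) u(1)] by blast
  qed
  then have fw: "f w \<in> N.F (Suc (Suc 0)) - N.F (Suc 0)" using f_F[OF w(1)] by blast
  have "(x i \<odot>\<^bsub>N\<^esub> f u) \<ominus>\<^bsub>N\<^esub> (v i \<odot>\<^bsub>N\<^esub> f w) \<in> N.F (Suc 0)" if i: "i \<in> {1..n}" for i
  proof -
    have vi: "v i \<in> carrier A" using funcset_mem[OF v i] by (rule M.K_closed)
    show ?thesis
      using f_F[OF xu[OF i]] uw_closed vi M.var_closed[OF i]
      by (simp add: f_minus f_smult M.lsmult_closed)
  qed
  then have "leading_coords A n x N NN 0 v (f u) (f w)"
    using fu fw unfolding leading_coords_def by blast
  then show ?thesis by blast
qed

context PBW_point_module
begin

lemma point_coords_nonempty: "point_coords A K n x M MM \<noteq> {}"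
proof -
  obtain u where u: "u \<in> F (Suc 0) - F 0" using F_strict by blast
  obtain w where w: "w \<in> F (Suc (Suc 0)) - F (Suc 0)" using F_strict by blast
  have w_closed: "w \<in> carrier M" using w F_mem by blast
  have "\<exists>r \<in> K. x i \<odot>\<^bsub>M\<^esub> u \<ominus>\<^bsub>M\<^esub> r \<odot>\<^bsub>M\<^esub> w \<in> F (Suc 0)" if "i \<in> {1..n}" for i
    using F_quotient_line[OF w var_smult_F[OF that]] u by blast
  then obtain r where r: "\<And>i. i \<in> {1..n} \<Longrightarrow> r i \<in> K"
    "\<And>i. i \<in> {1..n} \<Longrightarrow> x i \<odot>\<^bsub>M\<^esub> u \<ominus>\<^bsub>M\<^esub> r i \<odot>\<^bsub>M\<^esub> w \<in> F (Suc 0)" by metis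
  define v where "v = restrict r {1..n}"
  have v: "v \<in> {1..n} \<rightarrow>\<^sub>E K" using r(1) unfolding v_def by auto
  have lead: "leading_coords A n x M MM 0 v u w"
    using u w r(2) unfolding leading_coords_def v_def by auto
  obtain i where i: "i \<in> {1..n}" "x i \<odot>\<^bsub>M\<^esub> u \<notin> F (Suc 0)" using var_raises_degree[OF u] by blast
  have xu: "x i \<odot>\<^bsub>M\<^esub> u \<in> carrier M" using u F_mem var_closed[OF i(1)] by (blast intro: lsmult_closed)
  have "v i \<noteq> \<zero>"
  proof
    assume "v i = \<zero>"
    then have "r i = \<zero>" using i(1) by (simp add: v_def)
    then have "x i \<odot>\<^bsub>M\<^esub> u \<ominus>\<^bsub>M\<^esub> \<zero>\<^bsub>M\<^esub> \<in> F (Suc 0)" using r(2)[OF i(1)] w_closed by (simp add: zero_smult)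
    then show False
      using M.cong_mem[OF F_subgroup _ xu M.zero_closed] zero_F i(2) by blast
  qed
  then have "v \<in> nonzero_vectors A K n" using v i(1) unfolding nonzero_vectors_def by blast
  then show ?thesis using lead unfolding point_coords_def by blast
qed

text \<open>
  If \<open>u \<equiv> s u'\<close> and \<open>w \<equiv> t w'\<close>, then comparing the two expressions of \<open>x\<^sub>i u\<close> in terms of \<open>w'\<close> gives
  \<open>s v'\<^sub>i = t v\<^sub>i\<close>.  Conversely, \<open>l v\<close> is obtained by replacing \<open>u\<close> with \<open>l u\<close>.
\<close>

lemma point_coords_iff:
  assumes v: "v \<in> point_coords A K n x M MM"
  shows "v' \<in> point_coords A K n x M MM \<longleftrightarrow>
    v' \<in> nonzero_vectors A K n \<and> (\<exists>l \<in> K - {\<zero>}. \<forall>i \<in> {1..n}. v' i = l \<otimes> v i)"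
proof -
  have vec: "\<And>v i. v \<in> nonzero_vectors A K n \<Longrightarrow> i \<in> {1..n} \<Longrightarrow> v i \<in> K"
    unfolding nonzero_vectors_def by (auto simp: PiE_def Pi_def)
  obtain u w where v_vec: "v \<in> nonzero_vectors A K n" and lead: "leading_coords A n x M MM 0 v u w"
    using v unfolding point_coords_def by blast
  have u: "u \<in> F (Suc 0) - F 0" and w: "w \<in> F (Suc (Suc 0)) - F (Suc 0)"
    and xu: "\<And>i. i \<in> {1..n} \<Longrightarrow> x i \<odot>\<^bsub>M\<^esub> u \<ominus>\<^bsub>M\<^esub> v i \<odot>\<^bsub>M\<^esub> w \<in> F (Suc 0)"
    using lead unfolding leading_coords_def by blast+
  have uw_closed: "u \<in> carrier M" "w \<in> carrier M" using u w F_mem by blast+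
  show ?thesis
  proof (intro iffI conjI)
    assume v': "v' \<in> point_coords A K n x M MM"
    then show v'_vec: "v' \<in> nonzero_vectors A K n" unfolding point_coords_def by blast
    obtain u' w' where lead': "leading_coords A n x M MM 0 v' u' w'"
      using v' unfolding point_coords_def by blast
    have u': "u' \<in> F (Suc 0) - F 0" and w': "w' \<in> F (Suc (Suc 0)) - F (Suc 0)"
      and xu': "\<And>i. i \<in> {1..n} \<Longrightarrow> x i \<odot>\<^bsub>M\<^esub> u' \<ominus>\<^bsub>M\<^esub> v' i \<odot>\<^bsub>M\<^esub> w' \<in> F (Suc 0)"
      using lead' unfolding leading_coords_def by blast+
    have uw'_closed: "u' \<in> carrier M" "w' \<in> carrier M" using u' w' F_mem by blast+
    obtain s where s: "s \<in> K" "u \<ominus>\<^bsub>M\<^esub> s \<odot>\<^bsub>M\<^esub> u' \<in> F 0" using F_quotient_line[OF u'] u by blast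
    obtain t where t: "t \<in> K" "w \<ominus>\<^bsub>M\<^esub> t \<odot>\<^bsub>M\<^esub> w' \<in> F (Suc 0)" using F_quotient_line[OF w'] w by blast
    have s0: "s \<noteq> \<zero>" using multiple_mem_F_iff[OF u' s(1) _ s(2)] u by blast
    have t0: "t \<noteq> \<zero>" using multiple_mem_F_iff[OF w' t(1) _ t(2)] w by blast
    have eq: "s \<otimes> v' i = t \<otimes> v i" if i: "i \<in> {1..n}" for i
    proof -
      have vi: "v i \<in> K" and v'i: "v' i \<in> K" using vec v_vec v'_vec i by blast+
      note closed = K_closed[OF vi] K_closed[OF v'i] K_closed[OF s(1)] K_closed[OF t(1)] uw_closed uw'_closed
      have 1: "x i \<odot>\<^bsub>M\<^esub> u \<ominus>\<^bsub>M\<^esub> (s \<otimes> v' i) \<odot>\<^bsub>M\<^esub> w' \<in> F (Suc 0)"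
        using var_leading[OF lead' _ i s(1) _ s(2)] u v'_vec unfolding nonzero_vectors_def by blast
      have 2: "v i \<odot>\<^bsub>M\<^esub> w \<ominus>\<^bsub>M\<^esub> (t \<otimes> v i) \<odot>\<^bsub>M\<^esub> w' \<in> F (Suc 0)"
        using K_smult_F[OF vi t(2)] closed K_central[OF t(1) K_closed[OF vi]]
        by (simp add: smult_minus lsmult_closed flip: lsmult_assoc)
      have 3: "x i \<odot>\<^bsub>M\<^esub> u \<ominus>\<^bsub>M\<^esub> (t \<otimes> v i) \<odot>\<^bsub>M\<^esub> w' \<in> F (Suc 0)"
        by (rule M.cong_trans[OF F_subgroup xu[OF i] 2])
          (use closed var_closed[OF i] in \<open>auto intro!: lsmult_closed\<close>)
      let ?d = "s \<otimes> v' i \<ominus> t \<otimes> v i"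
      have d: "?d \<in> K" using s(1) t(1) vi v'i by (intro K_minus K_mult)
      have "(x i \<odot>\<^bsub>M\<^esub> u \<ominus>\<^bsub>M\<^esub> x i \<odot>\<^bsub>M\<^esub> u) \<ominus>\<^bsub>M\<^esub> ((s \<otimes> v' i) \<odot>\<^bsub>M\<^esub> w' \<ominus>\<^bsub>M\<^esub> (t \<otimes> v i) \<odot>\<^bsub>M\<^esub> w') \<in> F (Suc 0)"
        by (rule M.cong_minus[OF F_subgroup 1 3])
          (use closed var_closed[OF i] in \<open>auto intro!: lsmult_closed\<close>)
      moreover have "x i \<odot>\<^bsub>M\<^esub> u \<ominus>\<^bsub>M\<^esub> x i \<odot>\<^bsub>M\<^esub> u = \<zero>\<^bsub>M\<^esub>"
        using closed var_closed[OF i] by (simp add: a_minus_def M.r_neg lsmult_closed)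
      moreover have "(s \<otimes> v' i) \<odot>\<^bsub>M\<^esub> w' \<ominus>\<^bsub>M\<^esub> (t \<otimes> v i) \<odot>\<^bsub>M\<^esub> w' = ?d \<odot>\<^bsub>M\<^esub> w'"
        using closed by (simp add: minus_smult)
      ultimately have "\<zero>\<^bsub>M\<^esub> \<ominus>\<^bsub>M\<^esub> ?d \<odot>\<^bsub>M\<^esub> w' \<in> F (Suc 0)" by (simp only:)
      moreover have "?d \<odot>\<^bsub>M\<^esub> w' \<in> carrier M" using K_closed[OF d] uw'_closed by (simp add: lsmult_closed)
      ultimately have "?d \<odot>\<^bsub>M\<^esub> w' \<in> F (Suc 0)"
        using M.cong_mem[OF F_subgroup] M.zero_closed zero_F by blast
      then have "?d = \<zero>" using smult_mem_F_iff[OF d _ uw'_closed(2)] w' by blast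
      then show ?thesis using closed by simp
    qed
    have "v' i = (inv s \<otimes> t) \<otimes> v i" if i: "i \<in> {1..n}" for i
    proof -
      have "v i \<in> carrier A" "v' i \<in> carrier A" using vec[OF v_vec i] vec[OF v'_vec i] K_closed by auto
      moreover note K_closed[OF s(1)] K_closed[OF t(1)] K_closed[OF K_inv[OF s(1) s0]]
      moreover have "inv s \<otimes> (s \<otimes> v' i) = inv s \<otimes> (t \<otimes> v i)" using eq[OF i] by simp
      ultimately show ?thesis using K_l_inv[OF s(1) s0] by (simp flip: m_assoc)
    qed
    moreover have "inv s \<otimes> t \<in> K - {\<zero>}"
      using K_mult_nonzero[OF K_inv[OF s(1) s0] t(1) K_inv_nonzero[OF s(1) s0] t0] K_mult[OF K_inv[OF s(1) s0] t(1)] by blast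
    ultimately show "\<exists>l \<in> K - {\<zero>}. \<forall>i \<in> {1..n}. v' i = l \<otimes> v i" by blast
  next
    assume "v' \<in> nonzero_vectors A K n \<and> (\<exists>l \<in> K - {\<zero>}. \<forall>i \<in> {1..n}. v' i = l \<otimes> v i)"
    then obtain l where v'_vec: "v' \<in> nonzero_vectors A K n"
      and l: "l \<in> K" "l \<noteq> \<zero>" "\<And>i. i \<in> {1..n} \<Longrightarrow> v' i = l \<otimes> v i" by blast
    have "x i \<odot>\<^bsub>M\<^esub> (l \<odot>\<^bsub>M\<^esub> u) \<ominus>\<^bsub>M\<^esub> v' i \<odot>\<^bsub>M\<^esub> w \<in> F (Suc 0)" if i: "i \<in> {1..n}" for i
      using K_smult_F[OF l(1) xu[OF i]] uw_closed K_closed[OF l(1)] var_closed[OF i] K_closed[OF vec[OF v_vec i]]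
      by (simp add: l(3)[OF i] K_smult_commute[OF l(1)] smult_minus lsmult_assoc lsmult_closed)
    then have "leading_coords A n x M MM 0 v' (l \<odot>\<^bsub>M\<^esub> u) w"
      using u w smult_mem_F_iff[OF l(1,2) uw_closed(1)] unfolding leading_coords_def by blast
    then show "v' \<in> point_coords A K n x M MM" using v'_vec unfolding point_coords_def by blast
  qed
qed

lemma point_coords_projective: "point_coords A K n x M MM \<in> projective_points A K n"
proof -
  obtain v where v: "v \<in> point_coords A K n x M MM" using point_coords_nonempty by blast
  then have v_vec: "v \<in> nonzero_vectors A K n" unfolding point_coords_def by blast
  let ?r = "{(v, w). v \<in> nonzero_vectors A K n \<and> w \<in> nonzero_vectors A K n \<and>
    (\<exists>l \<in> K - {\<zero>}. \<forall>i \<in> {1..n}. w i = l \<otimes> v i)}"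
  have "point_coords A K n x M MM = ?r `` {v}" using point_coords_iff[OF v] v_vec by auto
  then show ?thesis unfolding projective_points_def using quotientI[OF v_vec, of ?r] by simp
qed

end

lemma point_coords_eqI:
  assumes "PBW_point_module A K n x M MM" "PBW_point_module A K n x N NN"
    and "v \<in> point_coords A K n x M MM" "v \<in> point_coords A K n x N NN"
  shows "point_coords A K n x M MM = point_coords A K n x N NN"
  using PBW_point_module.point_coords_iff[OF assms(1,3)] PBW_point_module.point_coords_iff[OF assms(2,4)]
  by blast

section \<open>The injection into projective space\<close>

text \<open>
  This is the heart of the matter: equal points have a common coordinate vector \<open>v\<close>, whose iterates
  under \<^const>\<open>next_coords\<close> describe both associated graded modules completely.
\<close>

lemma gr_isomorphic_iff_point_coords_eq:
  assumes "PBW_point_module A K n x M MM" "PBW_point_module A K n x N NN"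
    and rel: "relation_constants A K n x c"
  shows "graded_isomorphic (gr_ring A (pbw_piece A K n x)) (gr_module M MM) (gr_homogeneous M MM)
      (gr_module N NN) (gr_homogeneous N NN) \<longleftrightarrow>
    point_coords A K n x M MM = point_coords A K n x N NN"
    (is "?iso \<longleftrightarrow> ?eq")
proof -
  interpret M: PBW_point_module A K n x M MM by fact
  interpret N: PBW_point_module A K n x N NN by fact
  obtain v where v: "v \<in> point_coords A K n x M MM" using M.point_coords_nonempty by blast
  then obtain u w where v_vec: "v \<in> nonzero_vectors A K n" and lead: "leading_coords A n x M MM 0 v u w"
    unfolding point_coords_def by blast
  have vK: "v \<in> {1..n} \<rightarrow> K" using v_vec unfolding nonzero_vectors_def by blast
  show ?thesis
  proof
    assume ?iso
    moreover have "v i \<in> pbw_piece A K n x 0" if "i \<in> {1..n}" for i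
      using funcset_mem[OF vK that] by (rule M.K_in_piece)
    ultimately have "\<exists>u' w'. leading_coords A n x N NN 0 v u' w'"
      by (intro gr_isomorphism_leading_coords[OF M.semi_graded_axioms N.semi_graded_axioms _ M.var_in_piece _ lead])
    then have "v \<in> point_coords A K n x N NN" using v_vec unfolding point_coords_def by blast
    then show ?eq by (rule point_coords_eqI[OF assms(1,2) v])
  next
    assume ?eq
    then obtain u' w' where lead': "leading_coords A n x N NN 0 v u' w'"
      using v unfolding point_coords_def by blast
    obtain e where e: "\<And>k. leading_coords A n x M MM k ((next_coords A n c ^^ k) v) (e k) (e (Suc k))"
      using M.leading_coords_sequence[OF rel vK lead] by blast
    obtain e' where e': "\<And>k. leading_coords A n x N NN k ((next_coords A n c ^^ k) v) (e' k) (e' (Suc k))"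
      using N.leading_coords_sequence[OF rel vK lead'] by blast
    interpret matched_point_modules A K n x M MM N NN "\<lambda>k. (next_coords A n c ^^ k) v" e e'
      using M.next_coords_iterate_closed[OF rel vK e] e e' by unfold_locales
    show ?iso by (rule gr_correspondence.gr_modules_isomorphic[OF gr_correspondence])
  qed
qed

lemma graded_isomorphic_refl: "graded_isomorphic A M MM M MM"
proof -
  have "(\<lambda>m. m) \<in> left_module_iso A M M"
    unfolding left_module_iso_def iso_def hom_def bij_betw_def by auto
  then show ?thesis unfolding graded_isomorphic_def by (intro bexI[of _ "\<lambda>m. m"]) auto
qed

theorem theorem3p1:
  fixes A :: "('a, 'c) ring_scheme"
    and K :: "'a set"
    and n :: nat
    and x :: "nat \<Rightarrow> 'a"
    and c :: "nat \<Rightarrow> nat \<Rightarrow> 'a"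
  assumes "subfield K A"
    and "bijective_skew_PBW_extension A K n x"
    and "central_in K A"
    and "relation_constants A K n x c"
  shows "\<exists>m\<^sub>0 \<ge> 1. \<exists>f :: (('a, 'm) module \<times> (nat \<Rightarrow> 'm set)) set set \<Rightarrow> (nat \<Rightarrow> (nat \<Rightarrow> 'a) set).
           f \<in> (point_module_classes A K n x // gr_equiv_rel A K n x) \<rightarrow> X_set A K n c m\<^sub>0 \<and>
           inj_on f (point_module_classes A K n x // gr_equiv_rel A K n x)"
proof -
  interpret A: central_PBW_extension A K n x
    using assms(1-3) unfolding bijective_skew_PBW_extension_def
    by (intro central_PBW_extension.intro central_PBW_extension_axioms.intro) auto
  let ?PM = "point_modules A K n x :: (('a, 'm) module \<times> (nat \<Rightarrow> 'm set)) set"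
  let ?iso = "point_module_iso_rel A K n x :: (('a, 'm) module \<times> (nat \<Rightarrow> 'm set)) rel"
  let ?P = "point_module_classes A K n x :: (('a, 'm) module \<times> (nat \<Rightarrow> 'm set)) set set"
  let ?E = "gr_equiv_rel A K n x :: (('a, 'm) module \<times> (nat \<Rightarrow> 'm set)) set rel"
  let ?pt = "\<lambda>p. point_coords A K n x (fst p) (snd (p :: ('a, 'm) module \<times> (nat \<Rightarrow> 'm set)))"

  have PM: "PBW_point_module A K n x (fst p) (snd p)" if "p \<in> ?PM" for p
  proof -
    have pm: "point_module A K n x (fst p) (snd p)" using that by (auto simp: point_modules_def)
    then have "left_module A (fst p)"
      unfolding point_module_def semi_graded_module_def by blast
    moreover have "semi_graded_axioms A (fst p) (pbw_piece A K n x) (snd p)"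
      using pm A.PBW_piece_closed A.zero_in_PBW_piece
      unfolding point_module_def semi_graded_module_def by (intro semi_graded_axioms.intro) auto
    moreover have "PBW_point_module_axioms A K (fst p) (snd p)"
      using pm unfolding point_module_def by (intro PBW_point_module_axioms.intro) auto
    ultimately show ?thesis
      by (intro PBW_point_module.intro semi_graded.intro A.central_PBW_extension_axioms)
  qed
  have iso_pt: "?pt p = ?pt q" if "(p, q) \<in> ?iso" for p q
  proof -
    have XY: "p \<in> ?PM" "q \<in> ?PM" and iso: "graded_isomorphic A (fst p) (snd p) (fst q) (snd q)"
      using that unfolding point_module_iso_rel_def by auto
    obtain v where v: "v \<in> ?pt p" using PBW_point_module.point_coords_nonempty[OF PM[OF XY(1)]] by blast
    then obtain u w where v_vec: "v \<in> nonzero_vectors A K n"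
      and lead: "leading_coords A n x (fst p) (snd p) 0 v u w"
      unfolding point_coords_def by blast
    then have "v \<in> {1..n} \<rightarrow> K" unfolding nonzero_vectors_def by blast
    then have "v \<in> ?pt q"
      using isomorphism_leading_coords[OF PM[OF XY(1)] PM[OF XY(2)] iso _ lead] v_vec
      unfolding point_coords_def by blast
    then show ?thesis by (rule point_coords_eqI[OF PM[OF XY(1)] PM[OF XY(2)] v])
  qed
  have class_nonempty: "\<exists>p. p \<in> C" if "C \<in> ?P" for C
    using that graded_isomorphic_refl
    unfolding point_module_classes_def quotient_def point_module_iso_rel_def by fastforce
  have class_mem: "p \<in> ?PM" if "C \<in> ?P" "p \<in> C" for C p
    using that unfolding point_module_classes_def quotient_def point_module_iso_rel_def by auto
  have class_pt: "?pt p = ?pt q" if C: "C \<in> ?P" and pq: "p \<in> C" "q \<in> C" for C p q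
  proof -
    obtain s where "C = ?iso `` {s}"
      using C unfolding point_module_classes_def by (rule quotientE)
    then have "(s, p) \<in> ?iso" "(s, q) \<in> ?iso" using pq by blast+
    then show ?thesis using iso_pt by metis
  qed
  have E_iff: "(C, D) \<in> ?E \<longleftrightarrow> C \<in> ?P \<and> D \<in> ?P \<and> (\<exists>p \<in> C. \<exists>q \<in> D. ?pt p = ?pt q)" for C D
  proof -
    have "graded_isomorphic (gr_ring A (pbw_piece A K n x))
        (gr_module (fst p) (snd p)) (gr_homogeneous (fst p) (snd p))
        (gr_module (fst q) (snd q)) (gr_homogeneous (fst q) (snd q)) \<longleftrightarrow> ?pt p = ?pt q"
      if "C \<in> ?P" "D \<in> ?P" "p \<in> C" "q \<in> D" for p q
      by (rule gr_isomorphic_iff_point_coords_eq[OF PM[OF class_mem] PM[OF class_mem] assms(4)]) (rule that)+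
    then show ?thesis unfolding gr_equiv_rel_def case_prod_unfold by (simp cong: conj_cong bex_cong)
  qed

  \<comment> \<open>A class of classes is sent to the point of an arbitrary point module in it.\<close>
  define F where "F Q = (\<lambda>k \<in> {..<1::nat}. ?pt (SOME p. \<exists>C \<in> Q. p \<in> C))" for Q
  \<comment> \<open>The point determines the class: the equivalence is the kernel of \<open>?pt\<close>.\<close>
  have F: "\<exists>p. p \<in> ?PM \<and> F Q 0 = ?pt p \<and> Q = {C \<in> ?P. \<exists>q \<in> C. ?pt q = ?pt p}" if Q: "Q \<in> ?P // ?E" for Q
  proof -
    obtain C where C: "C \<in> ?P" "Q = ?E `` {C}" using Q by (rule quotientE)
    obtain p where p: "p \<in> C" using class_nonempty[OF C(1)] by blast
    have Q_eq: "Q = {D \<in> ?P. \<exists>q \<in> D. ?pt q = ?pt p}"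
    proof (intro equalityI subsetI)
      fix D assume "D \<in> Q"
      then obtain p' q where XY: "D \<in> ?P" "p' \<in> C" "q \<in> D" "?pt p' = ?pt q" using C(2) E_iff by auto
      moreover have "?pt p' = ?pt p" by (rule class_pt[OF C(1) XY(2) p])
      ultimately show "D \<in> {D \<in> ?P. \<exists>q \<in> D. ?pt q = ?pt p}" by auto
    next
      fix D assume "D \<in> {D \<in> ?P. \<exists>q \<in> D. ?pt q = ?pt p}"
      then obtain q where "D \<in> ?P" "q \<in> D" "?pt p = ?pt q" by auto
      then have "(C, D) \<in> ?E" unfolding E_iff using C(1) p by blast
      then show "D \<in> Q" using C(2) by blast
    qed
    have "C \<in> Q" using C(1) p Q_eq by blast
    then have "\<exists>q. \<exists>D \<in> Q. q \<in> D" using p by blast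
    then obtain D where D: "D \<in> Q" "(SOME q. \<exists>D \<in> Q. q \<in> D) \<in> D"
      using someI_ex[of "\<lambda>q. \<exists>D \<in> Q. q \<in> D"] by blast
    then obtain q where q: "D \<in> ?P" "q \<in> D" "?pt q = ?pt p" unfolding Q_eq by blast
    have "F Q 0 = ?pt p" unfolding F_def using class_pt[OF q(1) D(2) q(2)] q(3) by simp
    then show ?thesis using Q_eq class_mem[OF C(1) p] by blast
  qed
  have "F \<in> ?P // ?E \<rightarrow> X_set A K n c 1"
  proof
    fix Q assume "Q \<in> ?P // ?E"
    then obtain p where "p \<in> ?PM" "F Q 0 = ?pt p" using F by blast
    then have "F Q 0 \<in> projective_points A K n"
      using PBW_point_module.point_coords_projective[OF PM] by simp
    then have "F Q \<in> {..<1} \<rightarrow>\<^sub>E projective_points A K n" by (auto simp: F_def)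
    then show "F Q \<in> X_set A K n c 1" by (auto simp: X_set_def)
  qed
  moreover have "inj_on F (?P // ?E)"
  proof (rule inj_onI)
    fix Q Q' assume Q: "Q \<in> ?P // ?E" and Q': "Q' \<in> ?P // ?E" and eq: "F Q = F Q'"
    obtain p where p: "F Q 0 = ?pt p" "Q = {C \<in> ?P. \<exists>q \<in> C. ?pt q = ?pt p}" using F[OF Q] by blast
    obtain p' where p': "F Q' 0 = ?pt p'" "Q' = {C \<in> ?P. \<exists>q \<in> C. ?pt q = ?pt p'}" using F[OF Q'] by blast
    have "?pt p = ?pt p'" using p(1) p'(1) eq by simp
    then show "Q = Q'" unfolding p(2) p'(2) by simp
  qed
  ultimately show ?thesis by (intro exI[of _ "1::nat"] conjI exI[of _ F]) auto
qed

end
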